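(* If $(M,\phi,\xi,\eta,g)$ is an almost Kenmotsu $(\kappa,\mu,\nu)$-space with $\kappa<-1$ a function that only varies in the direction of $\xi$, then its Riemann curvature tensor can be written as $$R=-R_1-(\kappa+1)R_3-R_{5,2}-\mu R_6+R_7-(\nu-1)R_8 .$$ Therefore, $M$ is a generalized $(\kappa,\mu,\nu)$-space form with divided $R_5$, $M(f_1,\ldots,f_{5,1},f_{5,2},\ldots,f_8)$, with functions $$f_1=-1,\ f_2=0,\ f_3=-(\kappa+1),\ f_4=0,\ f_{5,1}=0,\ f_{5,2}=-1,\ f_6=-\mu,\ f_7=1,\ f_8=-(\nu-1).$$
   Context: Manifolds, tensor fields and functions are smooth. An almost contact metric manifold $(M,\phi,\xi,\eta,g)$ is an odd-dimensional Riemannian manifold $(M,g)$ with a $(1,1)$-tensor field $\phi$, a vector field $\xi$ and a 1-form $\eta$ such that $\eta(\xi)=1$, $\phi^2X=-X+\eta(X)\xi$ and $g(\phi X,\phi Y)=g(X,Y)-\eta(X)\eta(Y)$. Its fundamental 2-form is $\Phi(X,Y)=g(X,\phi Y)$. It is almost Kenmotsu if $d\eta=0$ and $d\Phi=2\eta\wedge\Phi$. Put $h=\frac12L_\xi\phi$ ($L$ the Lie derivative) and $R(X,Y)Z=\nabla_X\nabla_YZ-\nabla_Y\nabla_XZ-\nabla_{[X,Y]}Z$, with $\nabla$ the Levi-Civita connection. A function $f$ only varies in the direction of $\xi$ if $X(f)=0$ for every vector field $X$ orthogonal to $\xi$. A $(\kappa,\mu,\nu)$-space ($\kappa,\mu,\nu$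 smooth functions) is an almost contact metric manifold satisfying, for all $X,Y$, $$R(X,Y)\xi=\kappa\{\eta(Y)X-\eta(X)Y\}+\mu\{\eta(Y)hX-\eta(X)hY\}+\nu\{\eta(Y)\phi hX-\eta(X)\phi hY\}.$$ A generalized $(\kappa,\mu,\nu)$-space form with divided $R_5$, denoted $M(f_1,\ldots,f_{5,1},f_{5,2},\ldots,f_8)$, is an almost contact metric manifold whose curvature tensor can be written as $R=f_1R_1+f_2R_2+f_3R_3+f_4R_4+f_{5,1}R_{5,1}+f_{5,2}R_{5,2}+f_6R_6+f_7R_7+f_8R_8$ with $f_i$ functions on $M$, where for all vector fields $X,Y,Z$: $R_1(X,Y)Z=g(Y,Z)X-g(X,Z)Y$; $R_2(X,Y)Z=g(X,\phi Z)\phi Y-g(Y,\phi Z)\phi X+2g(X,\phi Y)\phi Z$; $R_3(X,Y)Z=\eta(X)\eta(Z)Y-\eta(Y)\eta(Z)X+g(X,Z)\eta(Y)\xi-g(Y,Z)\eta(X)\xi$; $R_4(X,Y)Z=g(Y,Z)hX-g(X,Z)hY+g(hY,Z)X-g(hX,Z)Y$; $R_{5,1}(X,Y)Z=g(hY,Z)hX-g(hX,Z)hY$; $R_{5,2}(X,Y)Z=g(\phi hY,Z)\phi hX-g(\phi hX,Z)\phi hY$; $R_6(X,Y)Z=\eta(X)\eta(Z)hY-\eta(Y)\eta(Z)hX+g(hX,Z)\eta(Y)\xi-g(hY,Z)\eta(X)\xi$; $R_7(X,Y)Z=g(Y,Z)\phi hX-g(X,Z)\phi hY+g(\phi hY,Z)X-g(\phi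 hX,Z)Y$; $R_8(X,Y)Z=\eta(X)\eta(Z)\phi hY-\eta(Y)\eta(Z)\phi hX+g(\phi hX,Z)\eta(Y)\xi-g(\phi hY,Z)\eta(X)\xi$. *)

theory Defs
  imports "HOL-Analysis.Analysis" "HOL-Library.Function_Algebras"
begin

text \<open>
  Real-valued functions, tangent vectors and vector fields are all (iterated) functions into the
  reals, so they are added and subtracted pointwise; the following instance supplies the
  pointwise multiplication by real scalars.
\<close>

instantiation "fun" :: (type, real_vector) real_vector
begin

definition scaleR_fun :: "real \<Rightarrow> ('a \<Rightarrow> 'b) \<Rightarrow> 'a \<Rightarrow> 'b"
  where "scaleR_fun c f = (\<lambda>x. c *\<^sub>R f x)"

instance
  by standard (simp_all add: scaleR_fun_def fun_eq_iff scaleR_add_right scaleR_add_left)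

end


section \<open>Smooth manifolds\<close>

text \<open>\<open>C\<^sup>k\<close> maps on open sets, in terms of iterated directional derivatives.\<close>

primrec Ck_on :: "nat \<Rightarrow> 'e::euclidean_space set \<Rightarrow> ('e \<Rightarrow> 'b::euclidean_space) \<Rightarrow> bool" where
  "Ck_on 0 S f \<longleftrightarrow> continuous_on S f"
| "Ck_on (Suc k) S f \<longleftrightarrow>
     (\<forall>x\<in>S. f differentiable (at x)) \<and> (\<forall>v. Ck_on k S (\<lambda>x. frechet_derivative f (at x) v))"

definition smooth_on :: "'e::euclidean_space set \<Rightarrow> ('e \<Rightarrow> 'b::euclidean_space) \<Rightarrow> bool"
  where "smooth_on S f \<longleftrightarrow> (\<forall>k. Ck_on k S f)"

type_synonym ('a, 'e) atlas = "('a set \<times> ('a \<Rightarrow> 'e)) set"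

text \<open>
  The manifold is a whole Hausdorff, second countable type, of dimension \<open>DIM('e)\<close>. The atlas
  need not be maximal, as any smooth atlas determines the smooth structure.
\<close>

definition smooth_atlas ::
    "('a::{t2_space, second_countable_topology}, 'e::euclidean_space) atlas \<Rightarrow> bool" where
  "smooth_atlas A \<longleftrightarrow>
     (\<Union>(U, \<psi>)\<in>A. U) = UNIV \<and>
     (\<forall>(U, \<psi>)\<in>A. open U \<and> open (\<psi> ` U) \<and> homeomorphism U (\<psi> ` U) \<psi> (inv_into U \<psi>)) \<and>
     (\<forall>(U, \<psi>)\<in>A. \<forall>(V, \<theta>)\<in>A. smooth_on (\<psi> ` (U \<inter> V)) (\<theta> \<circ> inv_into U \<psi>))"

definition smooth_functions ::
    "('a::{t2_space, second_countable_topology}, 'e::euclidean_space) atlas \<Rightarrow> ('a \<Rightarrow> real) set" where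
  "smooth_functions A = {f. \<forall>(U, \<psi>)\<in>A. smooth_on (\<psi> ` U) (f \<circ> inv_into U \<psi>)}"

text \<open>
  Tangent vectors at \<open>p\<close> are the derivations at \<open>p\<close> of the algebra of smooth functions. The
  functional is set to \<open>0\<close> on functions that are not smooth, so that equality of tangent vectors
  is equality of the underlying HOL functions.
\<close>

type_synonym 'a tangent_vector = "('a \<Rightarrow> real) \<Rightarrow> real"
type_synonym 'a vector_field = "'a \<Rightarrow> 'a tangent_vector"

definition tangent_space ::
    "('a::{t2_space, second_countable_topology}, 'e::euclidean_space) atlas \<Rightarrow> 'a \<Rightarrow>
     'a tangent_vector set" where
  "tangent_space A p = {v.
     (\<forall>f\<in>smooth_functions A. \<forall>k\<in>smooth_functions A.
        v (\<lambda>x. f x + k x) = v f + v k \<and>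
        v (\<lambda>x. f x * k x) = f p * v k + k p * v f) \<and>
     (\<forall>c. \<forall>f\<in>smooth_functions A. v (\<lambda>x. c * f x) = c * v f) \<and>
     (\<forall>f. f \<notin> smooth_functions A \<longrightarrow> v f = 0)}"

definition vf_apply :: "'a vector_field \<Rightarrow> ('a \<Rightarrow> real) \<Rightarrow> 'a \<Rightarrow> real" (infixr "\<rhd>" 75)
  where "X \<rhd> f = (\<lambda>p. X p f)"

definition vf_scale :: "('a \<Rightarrow> real) \<Rightarrow> 'a vector_field \<Rightarrow> 'a vector_field" (infixr "\<odot>" 75)
  where "f \<odot> X = (\<lambda>p. f p *\<^sub>R X p)"

definition vector_fields ::
    "('a::{t2_space, second_countable_topology}, 'e::euclidean_space) atlas \<Rightarrow> 'a vector_field set" where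
  "vector_fields A = {X. (\<forall>p. X p \<in> tangent_space A p) \<and>
     (\<forall>f\<in>smooth_functions A. X \<rhd> f \<in> smooth_functions A)}"

definition bracket :: "'a vector_field \<Rightarrow> 'a vector_field \<Rightarrow> 'a vector_field"
  where "bracket X Y = (\<lambda>p f. X p (Y \<rhd> f) - Y p (X \<rhd> f))"


section \<open>Tensor fields, differential forms and Riemannian metrics\<close>

text \<open>
  A tensor field is a map on smooth vector fields that is multilinear over the smooth functions.
  Its values on arguments that are not smooth vector fields are irrelevant.
\<close>

definition one_form ::
    "('a::{t2_space, second_countable_topology}, 'e::euclidean_space) atlas \<Rightarrow>
     ('a vector_field \<Rightarrow> 'a \<Rightarrow> real) \<Rightarrow> bool" where
  "one_form A \<eta> \<longleftrightarrow>
     (\<forall>X\<in>vector_fields A. \<eta> X \<in> smooth_functions A) \<and>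
     (\<forall>X\<in>vector_fields A. \<forall>Y\<in>vector_fields A. \<eta> (X + Y) = \<eta> X + \<eta> Y) \<and>
     (\<forall>f\<in>smooth_functions A. \<forall>X\<in>vector_fields A. \<eta> (f \<odot> X) = f * \<eta> X)"

definition tensor_11 ::
    "('a::{t2_space, second_countable_topology}, 'e::euclidean_space) atlas \<Rightarrow>
     ('a vector_field \<Rightarrow> 'a vector_field) \<Rightarrow> bool" where
  "tensor_11 A \<phi> \<longleftrightarrow>
     (\<forall>X\<in>vector_fields A. \<phi> X \<in> vector_fields A) \<and>
     (\<forall>X\<in>vector_fields A. \<forall>Y\<in>vector_fields A. \<phi> (X + Y) = \<phi> X + \<phi> Y) \<and>
     (\<forall>f\<in>smooth_functions A. \<forall>X\<in>vector_fields A. \<phi> (f \<odot> X) = f \<odot> \<phi> X)"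

definition riemannian_metric ::
    "('a::{t2_space, second_countable_topology}, 'e::euclidean_space) atlas \<Rightarrow>
     ('a vector_field \<Rightarrow> 'a vector_field \<Rightarrow> 'a \<Rightarrow> real) \<Rightarrow> bool" where
  "riemannian_metric A g \<longleftrightarrow>
     (\<forall>X\<in>vector_fields A. one_form A (g X)) \<and>
     (\<forall>X\<in>vector_fields A. \<forall>Y\<in>vector_fields A. g X Y = g Y X) \<and>
     (\<forall>X\<in>vector_fields A. \<forall>p. X p \<noteq> 0 \<longrightarrow> g X X p > 0)"

text \<open>
  Exterior derivatives and wedge product without the factors \<open>1/2\<close> and \<open>1/3\<close> that some authors
  include. The conditions \<open>d\<eta> = 0\<close> and \<open>d\<Phi> = 2 \<eta> \<and> \<Phi>\<close> are the same in both conventions.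
\<close>

definition d_one_form ::
    "('a vector_field \<Rightarrow> 'a \<Rightarrow> real) \<Rightarrow> 'a vector_field \<Rightarrow> 'a vector_field \<Rightarrow> 'a \<Rightarrow> real" where
  "d_one_form \<eta> X Y = X \<rhd> \<eta> Y - Y \<rhd> \<eta> X - \<eta> (bracket X Y)"

definition d_two_form ::
    "('a vector_field \<Rightarrow> 'a vector_field \<Rightarrow> 'a \<Rightarrow> real) \<Rightarrow>
     'a vector_field \<Rightarrow> 'a vector_field \<Rightarrow> 'a vector_field \<Rightarrow> 'a \<Rightarrow> real" where
  "d_two_form \<Phi> X Y Z =
     X \<rhd> \<Phi> Y Z - Y \<rhd> \<Phi> X Z + Z \<rhd> \<Phi> X Y
     - \<Phi> (bracket X Y) Z + \<Phi> (bracket X Z) Y - \<Phi> (bracket Y Z) X"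

definition wedge_12 ::
    "('a vector_field \<Rightarrow> 'a \<Rightarrow> real) \<Rightarrow> ('a vector_field \<Rightarrow> 'a vector_field \<Rightarrow> 'a \<Rightarrow> real) \<Rightarrow>
     'a vector_field \<Rightarrow> 'a vector_field \<Rightarrow> 'a vector_field \<Rightarrow> 'a \<Rightarrow> real" where
  "wedge_12 \<eta> \<Phi> X Y Z = \<eta> X * \<Phi> Y Z - \<eta> Y * \<Phi> X Z + \<eta> Z * \<Phi> X Y"

definition lie_derivative_11 ::
    "'a vector_field \<Rightarrow> ('a vector_field \<Rightarrow> 'a vector_field) \<Rightarrow> 'a vector_field \<Rightarrow> 'a vector_field" where
  "lie_derivative_11 \<xi> \<phi> X = bracket \<xi> (\<phi> X) - \<phi> (bracket \<xi> X)"

text \<open>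
  The Levi-Civita connection is given by its characterization; it exists and is unique (on
  smooth vector fields) for every Riemannian metric.
\<close>

definition affine_connection ::
    "('a::{t2_space, second_countable_topology}, 'e::euclidean_space) atlas \<Rightarrow>
     ('a vector_field \<Rightarrow> 'a vector_field \<Rightarrow> 'a vector_field) \<Rightarrow> bool" where
  "affine_connection A nab \<longleftrightarrow>
     (\<forall>Y\<in>vector_fields A. tensor_11 A (\<lambda>X. nab X Y)) \<and>
     (\<forall>X\<in>vector_fields A. \<forall>Y\<in>vector_fields A. \<forall>Z\<in>vector_fields A.
        nab X (Y + Z) = nab X Y + nab X Z) \<and>
     (\<forall>f\<in>smooth_functions A. \<forall>X\<in>vector_fields A. \<forall>Y\<in>vector_fields A.
        nab X (f \<odot> Y) = (X \<rhd> f) \<odot> Y + f \<odot> nab X Y)"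

definition levi_civita ::
    "('a::{t2_space, second_countable_topology}, 'e::euclidean_space) atlas \<Rightarrow>
     ('a vector_field \<Rightarrow> 'a vector_field \<Rightarrow> 'a \<Rightarrow> real) \<Rightarrow>
     ('a vector_field \<Rightarrow> 'a vector_field \<Rightarrow> 'a vector_field) \<Rightarrow> bool" where
  "levi_civita A g nab \<longleftrightarrow>
     affine_connection A nab \<and>
     (\<forall>X\<in>vector_fields A. \<forall>Y\<in>vector_fields A. nab X Y - nab Y X = bracket X Y) \<and>
     (\<forall>X\<in>vector_fields A. \<forall>Y\<in>vector_fields A. \<forall>Z\<in>vector_fields A.
        X \<rhd> g Y Z = g (nab X Y) Z + g Y (nab X Z))"

definition curvature ::
    "('a vector_field \<Rightarrow> 'a vector_field \<Rightarrow> 'a vector_field) \<Rightarrow>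
     'a vector_field \<Rightarrow> 'a vector_field \<Rightarrow> 'a vector_field \<Rightarrow> 'a vector_field" where
  "curvature nab X Y Z = nab X (nab Y Z) - nab Y (nab X Z) - nab (bracket X Y) Z"


section \<open>Almost contact metric geometry\<close>

definition almost_contact_metric ::
    "('a::{t2_space, second_countable_topology}, 'e::euclidean_space) atlas \<Rightarrow>
     ('a vector_field \<Rightarrow> 'a vector_field) \<Rightarrow> 'a vector_field \<Rightarrow> ('a vector_field \<Rightarrow> 'a \<Rightarrow> real) \<Rightarrow>
     ('a vector_field \<Rightarrow> 'a vector_field \<Rightarrow> 'a \<Rightarrow> real) \<Rightarrow> bool" where
  "almost_contact_metric A \<phi> \<xi> \<eta> g \<longleftrightarrow>
     smooth_atlas A \<and> odd (DIM('e)) \<and> riemannian_metric A g \<and>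
     tensor_11 A \<phi> \<and> \<xi> \<in> vector_fields A \<and> one_form A \<eta> \<and>
     \<eta> \<xi> = 1 \<and>
     (\<forall>X\<in>vector_fields A. \<phi> (\<phi> X) = - X + \<eta> X \<odot> \<xi>) \<and>
     (\<forall>X\<in>vector_fields A. \<forall>Y\<in>vector_fields A. g (\<phi> X) (\<phi> Y) = g X Y - \<eta> X * \<eta> Y)"

definition fundamental_form ::
    "('a vector_field \<Rightarrow> 'a vector_field) \<Rightarrow> ('a vector_field \<Rightarrow> 'a vector_field \<Rightarrow> 'a \<Rightarrow> real) \<Rightarrow>
     'a vector_field \<Rightarrow> 'a vector_field \<Rightarrow> 'a \<Rightarrow> real" where
  "fundamental_form \<phi> g X Y = g X (\<phi> Y)"

definition almost_kenmotsu ::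
    "('a::{t2_space, second_countable_topology}, 'e::euclidean_space) atlas \<Rightarrow>
     ('a vector_field \<Rightarrow> 'a vector_field) \<Rightarrow> 'a vector_field \<Rightarrow> ('a vector_field \<Rightarrow> 'a \<Rightarrow> real) \<Rightarrow>
     ('a vector_field \<Rightarrow> 'a vector_field \<Rightarrow> 'a \<Rightarrow> real) \<Rightarrow> bool" where
  "almost_kenmotsu A \<phi> \<xi> \<eta> g \<longleftrightarrow>
     almost_contact_metric A \<phi> \<xi> \<eta> g \<and>
     (\<forall>X\<in>vector_fields A. \<forall>Y\<in>vector_fields A. d_one_form \<eta> X Y = 0) \<and>
     (\<forall>X\<in>vector_fields A. \<forall>Y\<in>vector_fields A. \<forall>Z\<in>vector_fields A.
        d_two_form (fundamental_form \<phi> g) X Y Z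
          = 2 *\<^sub>R wedge_12 \<eta> (fundamental_form \<phi> g) X Y Z)"

definition h_tensor ::
    "('a vector_field \<Rightarrow> 'a vector_field) \<Rightarrow> 'a vector_field \<Rightarrow> 'a vector_field \<Rightarrow> 'a vector_field" where
  "h_tensor \<phi> \<xi> X = (1/2) *\<^sub>R lie_derivative_11 \<xi> \<phi> X"

definition varies_only_along ::
    "('a::{t2_space, second_countable_topology}, 'e::euclidean_space) atlas \<Rightarrow>
     ('a vector_field \<Rightarrow> 'a vector_field \<Rightarrow> 'a \<Rightarrow> real) \<Rightarrow> 'a vector_field \<Rightarrow> ('a \<Rightarrow> real) \<Rightarrow> bool" where
  "varies_only_along A g \<xi> f \<longleftrightarrow> (\<forall>X\<in>vector_fields A. g X \<xi> = 0 \<longrightarrow> X \<rhd> f = 0)"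

definition kmn_space ::
    "('a::{t2_space, second_countable_topology}, 'e::euclidean_space) atlas \<Rightarrow>
     ('a vector_field \<Rightarrow> 'a vector_field) \<Rightarrow> 'a vector_field \<Rightarrow> ('a vector_field \<Rightarrow> 'a \<Rightarrow> real) \<Rightarrow>
     ('a vector_field \<Rightarrow> 'a vector_field \<Rightarrow> 'a \<Rightarrow> real) \<Rightarrow>
     ('a vector_field \<Rightarrow> 'a vector_field \<Rightarrow> 'a vector_field) \<Rightarrow>
     ('a \<Rightarrow> real) \<Rightarrow> ('a \<Rightarrow> real) \<Rightarrow> ('a \<Rightarrow> real) \<Rightarrow> bool" where
  "kmn_space A \<phi> \<xi> \<eta> g nab \<kappa> \<mu> \<nu> \<longleftrightarrow>
     almost_contact_metric A \<phi> \<xi> \<eta> g \<and> levi_civita A g nab \<and>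
     \<kappa> \<in> smooth_functions A \<and> \<mu> \<in> smooth_functions A \<and> \<nu> \<in> smooth_functions A \<and>
     (\<forall>X\<in>vector_fields A. \<forall>Y\<in>vector_fields A.
        curvature nab X Y \<xi> =
          \<kappa> \<odot> (\<eta> Y \<odot> X - \<eta> X \<odot> Y)
          + \<mu> \<odot> (\<eta> Y \<odot> h_tensor \<phi> \<xi> X - \<eta> X \<odot> h_tensor \<phi> \<xi> Y)
          + \<nu> \<odot> (\<eta> Y \<odot> \<phi> (h_tensor \<phi> \<xi> X) - \<eta> X \<odot> \<phi> (h_tensor \<phi> \<xi> Y)))"

text \<open>
  In the tensors below \<open>h\<close> is an arbitrary operator on vector fields; it is instantiated with
  \<open>h_tensor \<phi> \<xi>\<close>.
\<close>

context
  fixes \<phi> h :: "'a vector_field \<Rightarrow> 'a vector_field"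
    and \<xi> :: "'a vector_field"
    and \<eta> :: "'a vector_field \<Rightarrow> 'a \<Rightarrow> real"
    and g :: "'a vector_field \<Rightarrow> 'a vector_field \<Rightarrow> 'a \<Rightarrow> real"
begin

definition R1 :: "'a vector_field \<Rightarrow> 'a vector_field \<Rightarrow> 'a vector_field \<Rightarrow> 'a vector_field" where
  "R1 X Y Z = g Y Z \<odot> X - g X Z \<odot> Y"

definition R2 :: "'a vector_field \<Rightarrow> 'a vector_field \<Rightarrow> 'a vector_field \<Rightarrow> 'a vector_field" where
  "R2 X Y Z = g X (\<phi> Z) \<odot> \<phi> Y - g Y (\<phi> Z) \<odot> \<phi> X + 2 *\<^sub>R (g X (\<phi> Y) \<odot> \<phi> Z)"

definition R3 :: "'a vector_field \<Rightarrow> 'a vector_field \<Rightarrow> 'a vector_field \<Rightarrow> 'a vector_field" where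
  "R3 X Y Z = (\<eta> X * \<eta> Z) \<odot> Y - (\<eta> Y * \<eta> Z) \<odot> X + (g X Z * \<eta> Y) \<odot> \<xi> - (g Y Z * \<eta> X) \<odot> \<xi>"

definition R4 :: "'a vector_field \<Rightarrow> 'a vector_field \<Rightarrow> 'a vector_field \<Rightarrow> 'a vector_field" where
  "R4 X Y Z = g Y Z \<odot> h X - g X Z \<odot> h Y + g (h Y) Z \<odot> X - g (h X) Z \<odot> Y"

definition R51 :: "'a vector_field \<Rightarrow> 'a vector_field \<Rightarrow> 'a vector_field \<Rightarrow> 'a vector_field" where
  "R51 X Y Z = g (h Y) Z \<odot> h X - g (h X) Z \<odot> h Y"

definition R52 :: "'a vector_field \<Rightarrow> 'a vector_field \<Rightarrow> 'a vector_field \<Rightarrow> 'a vector_field" where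
  "R52 X Y Z = g (\<phi> (h Y)) Z \<odot> \<phi> (h X) - g (\<phi> (h X)) Z \<odot> \<phi> (h Y)"

definition R6 :: "'a vector_field \<Rightarrow> 'a vector_field \<Rightarrow> 'a vector_field \<Rightarrow> 'a vector_field" where
  "R6 X Y Z = (\<eta> X * \<eta> Z) \<odot> h Y - (\<eta> Y * \<eta> Z) \<odot> h X
     + (g (h X) Z * \<eta> Y) \<odot> \<xi> - (g (h Y) Z * \<eta> X) \<odot> \<xi>"

definition R7 :: "'a vector_field \<Rightarrow> 'a vector_field \<Rightarrow> 'a vector_field \<Rightarrow> 'a vector_field" where
  "R7 X Y Z = g Y Z \<odot> \<phi> (h X) - g X Z \<odot> \<phi> (h Y) + g (\<phi> (h Y)) Z \<odot> X - g (\<phi> (h X)) Z \<odot> Y"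

definition R8 :: "'a vector_field \<Rightarrow> 'a vector_field \<Rightarrow> 'a vector_field \<Rightarrow> 'a vector_field" where
  "R8 X Y Z = (\<eta> X * \<eta> Z) \<odot> \<phi> (h Y) - (\<eta> Y * \<eta> Z) \<odot> \<phi> (h X)
     + (g (\<phi> (h X)) Z * \<eta> Y) \<odot> \<xi> - (g (\<phi> (h Y)) Z * \<eta> X) \<odot> \<xi>"

end

definition gen_kmn_space_form_divided ::
    "('a::{t2_space, second_countable_topology}, 'e::euclidean_space) atlas \<Rightarrow>
     ('a vector_field \<Rightarrow> 'a vector_field) \<Rightarrow> 'a vector_field \<Rightarrow> ('a vector_field \<Rightarrow> 'a \<Rightarrow> real) \<Rightarrow>
     ('a vector_field \<Rightarrow> 'a vector_field \<Rightarrow> 'a \<Rightarrow> real) \<Rightarrow>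
     ('a vector_field \<Rightarrow> 'a vector_field \<Rightarrow> 'a vector_field) \<Rightarrow>
     ('a \<Rightarrow> real) \<Rightarrow> ('a \<Rightarrow> real) \<Rightarrow> ('a \<Rightarrow> real) \<Rightarrow> ('a \<Rightarrow> real) \<Rightarrow> ('a \<Rightarrow> real) \<Rightarrow>
     ('a \<Rightarrow> real) \<Rightarrow> ('a \<Rightarrow> real) \<Rightarrow> ('a \<Rightarrow> real) \<Rightarrow> ('a \<Rightarrow> real) \<Rightarrow> bool" where
  "gen_kmn_space_form_divided A \<phi> \<xi> \<eta> g nab f1 f2 f3 f4 f51 f52 f6 f7 f8 \<longleftrightarrow>
     almost_contact_metric A \<phi> \<xi> \<eta> g \<and> levi_civita A g nab \<and>
     {f1, f2, f3, f4, f51, f52, f6, f7, f8} \<subseteq> smooth_functions A \<and>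
     (\<forall>X\<in>vector_fields A. \<forall>Y\<in>vector_fields A. \<forall>Z\<in>vector_fields A.
        let h = h_tensor \<phi> \<xi> in
        curvature nab X Y Z =
          f1 \<odot> R1 g X Y Z + f2 \<odot> R2 \<phi> g X Y Z + f3 \<odot> R3 \<xi> \<eta> g X Y Z + f4 \<odot> R4 h g X Y Z
          + f51 \<odot> R51 h g X Y Z + f52 \<odot> R52 \<phi> h g X Y Z + f6 \<odot> R6 h \<xi> \<eta> g X Y Z
          + f7 \<odot> R7 \<phi> h g X Y Z + f8 \<odot> R8 \<phi> h \<xi> \<eta> g X Y Z)"

end

theory Submission
  imports Defs
begin

text \<open>
  Since \<open>\<eta>\<close> is closed, \<open>D = ker \<eta>\<close> is integrable. The theorem says that its leaves, with the
  induced metric, are flat; everything else in the formula for \<open>R\<close> is extrinsic geometry of the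
  leaves together with the nullity condition.

  The almost Kenmotsu equations give \<open>\<nabla>\<^sub>X \<xi> = X - \<eta>(X) \<xi> + H X\<close> with \<open>H\<close> symmetric,
  \<open>H \<xi> = 0\<close>, \<open>H \<phi> = - \<phi> H\<close>, and \<open>h = \<phi> H\<close>. So the shape operator of the leaves is
  \<open>1 + H\<close>, and by the Gauss equation, flatness of the leaves amounts to
  \<open>R(X,Y)Z = g((1+H)X, Z) (1+H)Y - g((1+H)Y, Z) (1+H)X\<close> on \<open>D\<close>. As \<open>\<phi> h = - H\<close>, the right hand
  side is \<open>- R1 - R52 + R7\<close> there. When one argument is \<open>\<xi>\<close>, pair symmetry of the curvature reduces
  the formula to the nullity condition. Both sides are algebraic curvature tensors, so these two
  cases suffice (\<open>curvature_like_zero\<close>).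

  For flatness (\<open>split_almost_kaehler.flat\<close>), the part of \<open>R(X,\<xi>)\<xi>\<close> that commutes with \<open>\<phi>\<close>
  yields \<open>H\<^sup>2 = - (\<kappa>+1)\<close> on \<open>D\<close>, a positive function that is constant on each leaf, and
  \<open>R(X,Y)\<xi> = 0\<close> for horizontal \<open>X, Y\<close> is the Codazzi equation for \<open>H\<close>. A Codazzi operator with two
  constant eigenvalues is parallel, so a leaf is locally a Riemannian product of the eigenspaces
  of \<open>H\<close>, which \<open>\<phi>\<close> interchanges. The fundamental form is closed on the leaf, and for this
  special position of \<open>\<phi>\<close> closedness forces \<open>\<phi>\<close> to be parallel too. The curvature of the leaf then
  commutes with \<open>\<phi>\<close>. It vanishes on the pairs \<open>X, Y\<close> from different factors, and for \<open>X, Y\<close> in one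
  factor it kills the other factor; since \<open>\<phi>\<close> interchanges the factors, it is zero.

  The eigenspaces themselves are never used: each step is an identity between multilinear
  expressions in \<open>H\<close> and \<open>\<phi>\<close>, in which a symmetry in one pair of arguments meets a skew symmetry
  in an overlapping pair. Leaves are not constructed either: a distribution is represented by the
  module of its sections, and the induced connection is a connection on that module.
\<close>


section \<open>Smooth functions and vector fields\<close>

text \<open>
  Differentiability at a point of an open set and the derivative there only depend on the values on
  that set; the product and sum rules below, which hold only on the chart domain, rest on this.
\<close>
lemma Ck_on_cong:
  assumes "open S" "\<And>x. x \<in> S \<Longrightarrow> f x = f' x" "Ck_on k S f"
  shows "Ck_on k S f'"
  using assms(2,3)
proof (induction k arbitrary: f f')
  case 0
  then show ?case by (metis Ck_on.simps(1) continuous_on_cong)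
next
  case (Suc k)
  have diff: "f differentiable (at x)" if "x \<in> S" for x
    using Suc.prems that by simp
  have "f' differentiable (at x)" if "x \<in> S" for x
    using diff[OF that] assms(1) Suc.prems(1) that
    by (meson differentiable_def has_derivative_transform_within_open)
  moreover have "Ck_on k S (\<lambda>x. frechet_derivative f' (at x) v)" for v
  proof (rule Suc.IH)
    show "Ck_on k S (\<lambda>x. frechet_derivative f (at x) v)" using Suc.prems(2) by simp
    show "frechet_derivative f (at x) v = frechet_derivative f' (at x) v" if "x \<in> S" for x
      using frechet_derivative_transform_within_open[OF diff[OF that] assms(1) that] Suc.prems(1)
      by simp
  qed
  ultimately show ?case by simp
qed

lemma Ck_on_SucD: "Ck_on (Suc k) S f \<Longrightarrow> Ck_on k S f"
proof (induction k arbitrary: f)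
  case 0
  then show ?case
    by (auto intro!: continuous_at_imp_continuous_on differentiable_imp_continuous_within)
qed auto

lemma Ck_on_const: "Ck_on k S (\<lambda>x. c)"
  by (induction k arbitrary: c) auto

lemma Ck_on_add:
  assumes "open S" "Ck_on k S f" "Ck_on k S f'"
  shows "Ck_on k S (\<lambda>x. f x + f' x)"
  using assms(2,3)
proof (induction k arbitrary: f f')
  case 0
  then show ?case by (auto intro: continuous_on_add)
next
  case (Suc k)
  have "Ck_on k S (\<lambda>x. frechet_derivative (\<lambda>x. f x + f' x) (at x) v)" for v
  proof (rule Ck_on_cong[OF assms(1)])
    show "Ck_on k S (\<lambda>x. frechet_derivative f (at x) v + frechet_derivative f' (at x) v)"
      using Suc by simp
    show "frechet_derivative f (at x) v + frechet_derivative f' (at x) v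
        = frechet_derivative (\<lambda>x. f x + f' x) (at x) v" if "x \<in> S" for x
    proof -
      have "(f has_derivative frechet_derivative f (at x)) (at x)"
        and "(f' has_derivative frechet_derivative f' (at x)) (at x)"
        using Suc.prems that by (simp_all add: frechet_derivative_works[symmetric])
      from has_derivative_add[OF this] show ?thesis
        by (simp add: frechet_derivative_at[symmetric])
    qed
  qed
  then show ?case using Suc.prems by auto
qed

lemma Ck_on_mult:
  fixes f f' :: "'e::euclidean_space \<Rightarrow> real"
  assumes "open S" "Ck_on k S f" "Ck_on k S f'"
  shows "Ck_on k S (\<lambda>x. f x * f' x)"
  using assms(2,3)
proof (induction k arbitrary: f f')
  case 0
  then show ?case by (auto intro: continuous_on_mult)
next
  case (Suc k)
  have "Ck_on k S (\<lambda>x. frechet_derivative (\<lambda>x. f x * f' x) (at x) v)" for v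
  proof (rule Ck_on_cong[OF assms(1)])
    show "Ck_on k S (\<lambda>x. f x * frechet_derivative f' (at x) v + frechet_derivative f (at x) v * f' x)"
      using Suc.prems Ck_on_SucD[OF Suc.prems(1)] Ck_on_SucD[OF Suc.prems(2)]
      by (intro Ck_on_add assms(1) Suc.IH) auto
    show "f x * frechet_derivative f' (at x) v + frechet_derivative f (at x) v * f' x
        = frechet_derivative (\<lambda>x. f x * f' x) (at x) v" if "x \<in> S" for x
    proof -
      have "(f has_derivative frechet_derivative f (at x)) (at x)"
        and "(f' has_derivative frechet_derivative f' (at x)) (at x)"
        using Suc.prems that by (simp_all add: frechet_derivative_works[symmetric])
      from has_derivative_mult[OF this] show ?thesis
        by (simp add: frechet_derivative_at[symmetric])
    qed
  qed
  then show ?case using Suc.prems by auto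
qed

lemma smooth_const: "(\<lambda>x. c) \<in> smooth_functions A"
  by (auto simp: smooth_functions_def smooth_on_def o_def Ck_on_const)

lemma smooth_zero: "0 \<in> smooth_functions A"
  and smooth_one: "1 \<in> smooth_functions A"
  by (simp_all add: zero_fun_def one_fun_def smooth_const)

lemma smooth_add:
  assumes "smooth_atlas A" "f \<in> smooth_functions A" "k \<in> smooth_functions A"
  shows "f + k \<in> smooth_functions A"
proof -
  have "smooth_on (\<psi> ` U) ((f + k) \<circ> inv_into U \<psi>)" if "(U, \<psi>) \<in> A" for U \<psi>
  proof -
    have "open (\<psi> ` U)" using assms(1) that unfolding smooth_atlas_def by auto
    then show ?thesis using assms(2,3) that Ck_on_add[of "\<psi> ` U"]
      by (force simp: smooth_functions_def smooth_on_def o_def)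
  qed
  then show ?thesis by (auto simp: smooth_functions_def)
qed

lemma smooth_mult:
  assumes "smooth_atlas A" "f \<in> smooth_functions A" "k \<in> smooth_functions A"
  shows "f * k \<in> smooth_functions A"
proof -
  have "smooth_on (\<psi> ` U) ((f * k) \<circ> inv_into U \<psi>)" if "(U, \<psi>) \<in> A" for U \<psi>
  proof -
    have "open (\<psi> ` U)" using assms(1) that unfolding smooth_atlas_def by auto
    then show ?thesis using assms(2,3) that Ck_on_mult[of "\<psi> ` U"]
      by (force simp: smooth_functions_def smooth_on_def o_def)
  qed
  then show ?thesis by (auto simp: smooth_functions_def)
qed

lemma smooth_uminus:
  assumes "smooth_atlas A" "f \<in> smooth_functions A"
  shows "- f \<in> smooth_functions A"
proof -
  have "- f = (\<lambda>x. -1) * f" by (simp add: fun_eq_iff)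
  then show ?thesis using smooth_mult[OF assms(1) smooth_const assms(2)] by metis
qed

lemma smooth_diff:
  assumes "smooth_atlas A" "f \<in> smooth_functions A" "k \<in> smooth_functions A"
  shows "f - k \<in> smooth_functions A"
  using smooth_add[OF assms(1,2) smooth_uminus[OF assms(1,3)]] by simp

lemma tangentD:
  assumes "v \<in> tangent_space A p"
  shows "f \<in> smooth_functions A \<Longrightarrow> k \<in> smooth_functions A \<Longrightarrow> v (f + k) = v f + v k"
    and "f \<in> smooth_functions A \<Longrightarrow> k \<in> smooth_functions A \<Longrightarrow> v (f * k) = f p * v k + k p * v f"
    and "f \<in> smooth_functions A \<Longrightarrow> v (\<lambda>x. c * f x) = c * v f"
    and "f \<notin> smooth_functions A \<Longrightarrow> v f = 0"
  using assms by (auto simp: tangent_space_def plus_fun_def times_fun_def)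

lemma tangent_uminus:
  assumes "v \<in> tangent_space A p" "f \<in> smooth_functions A"
  shows "v (- f) = - v f"
proof -
  have "- f = (\<lambda>x. -1 * f x)" by (simp add: fun_eq_iff)
  then show ?thesis using tangentD(3)[OF assms, of "-1"] by simp
qed

lemma tangent_diff:
  assumes "smooth_atlas A" "v \<in> tangent_space A p"
    and "f \<in> smooth_functions A" "k \<in> smooth_functions A"
  shows "v (f - k) = v f - v k"
  using tangentD(1)[OF assms(2,3) smooth_uminus[OF assms(1,4)]] tangent_uminus[OF assms(2,4)]
  by simp

lemma tangent_const:
  assumes "v \<in> tangent_space A p"
  shows "v (\<lambda>x. c) = 0"
proof -
  have "v (\<lambda>x. 1) = 0"
    using tangentD(2)[OF assms, of "\<lambda>x. 1" "\<lambda>x. 1"] by (simp add: smooth_const times_fun_def)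
  then show ?thesis using tangentD(3)[OF assms, of "\<lambda>x. 1" c] by (simp add: smooth_const)
qed

lemma tangent_space_add:
  assumes "v \<in> tangent_space A p" "w \<in> tangent_space A p"
  shows "v + w \<in> tangent_space A p"
  using assms by (auto simp: tangent_space_def algebra_simps)

lemma tangent_space_scale:
  assumes "v \<in> tangent_space A p"
  shows "c *\<^sub>R v \<in> tangent_space A p"
  using assms by (auto simp: tangent_space_def scaleR_fun_def algebra_simps)

lemma vector_fieldD:
  assumes "X \<in> vector_fields A"
  shows "X p \<in> tangent_space A p"
    and "f \<in> smooth_functions A \<Longrightarrow> X \<rhd> f \<in> smooth_functions A"
  using assms by (auto simp: vector_fields_def)

lemma vector_field_add:
  assumes "smooth_atlas A" "X \<in> vector_fields A" "Y \<in> vector_fields A"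
  shows "X + Y \<in> vector_fields A"
proof -
  have "(X + Y) \<rhd> f = X \<rhd> f + Y \<rhd> f" for f by (simp add: vf_apply_def fun_eq_iff)
  then show ?thesis using assms
    by (auto simp: vector_fields_def intro: tangent_space_add smooth_add)
qed

lemma vector_field_scale:
  assumes "smooth_atlas A" "f \<in> smooth_functions A" "X \<in> vector_fields A"
  shows "f \<odot> X \<in> vector_fields A"
proof -
  have "(f \<odot> X) \<rhd> k = f * (X \<rhd> k)" for k
    by (simp add: vf_apply_def vf_scale_def scaleR_fun_def fun_eq_iff)
  then show ?thesis using assms
    by (auto simp: vector_fields_def vf_scale_def[of f X] intro: tangent_space_scale smooth_mult)
qed

lemma vf_scale_simps:
  "f \<odot> (X + Y) = f \<odot> X + f \<odot> Y" "f \<odot> (X - Y) = f \<odot> X - f \<odot> Y" "f \<odot> (- X) = - (f \<odot> X)"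
  "(f + k) \<odot> X = f \<odot> X + k \<odot> X" "(f - k) \<odot> X = f \<odot> X - k \<odot> X" "(- f) \<odot> X = - (f \<odot> X)"
  "f \<odot> (k \<odot> X) = (f * k) \<odot> X" "1 \<odot> X = X" "0 \<odot> X = 0" "f \<odot> 0 = (0 :: 'a vector_field)"
  by (simp_all add: vf_scale_def scaleR_fun_def fun_eq_iff algebra_simps)

declare vf_scale_simps(8-10) [simp]

lemma vector_field_uminus:
  assumes "smooth_atlas A" "X \<in> vector_fields A"
  shows "- X \<in> vector_fields A"
  using vector_field_scale[OF assms(1) smooth_uminus[OF assms(1) smooth_one] assms(2)]
  by (simp add: vf_scale_simps)

lemma bracket_vector_field:
  assumes at: "smooth_atlas A" and X: "X \<in> vector_fields A" and Y: "Y \<in> vector_fields A"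
  shows "bracket X Y \<in> vector_fields A"
proof -
  note [simp] = vector_fieldD[OF X] vector_fieldD[OF Y]
  note sm = smooth_add[OF at] smooth_mult[OF at]
  have app: "bracket X Y \<rhd> f = X \<rhd> (Y \<rhd> f) - Y \<rhd> (X \<rhd> f)" for f
    by (simp add: vf_apply_def bracket_def fun_eq_iff)
  have add: "X \<rhd> (f + k) = X \<rhd> f + X \<rhd> k" "Y \<rhd> (f + k) = Y \<rhd> f + Y \<rhd> k"
    and mult: "X \<rhd> (f * k) = f * (X \<rhd> k) + k * (X \<rhd> f)" "Y \<rhd> (f * k) = f * (Y \<rhd> k) + k * (Y \<rhd> f)"
    if "f \<in> smooth_functions A" "k \<in> smooth_functions A" for f k
    using that tangentD(1,2)[OF vector_fieldD(1)[OF X]] tangentD(1,2)[OF vector_fieldD(1)[OF Y]]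
    by (auto simp: vf_apply_def fun_eq_iff)
  have cm: "X \<rhd> (\<lambda>x. c * f x) = (\<lambda>x. c * (X \<rhd> f) x)" "Y \<rhd> (\<lambda>x. c * f x) = (\<lambda>x. c * (Y \<rhd> f) x)"
    if "f \<in> smooth_functions A" for f c
    using that tangentD(3)[OF vector_fieldD(1)[OF X]] tangentD(3)[OF vector_fieldD(1)[OF Y]]
    by (auto simp: vf_apply_def fun_eq_iff)
  have tan: "bracket X Y p \<in> tangent_space A p" for p
  proof -
    have pt: "bracket X Y p f = (bracket X Y \<rhd> f) p" for f by (simp add: vf_apply_def)
    have 1: "bracket X Y \<rhd> (f + k) = bracket X Y \<rhd> f + bracket X Y \<rhd> k"
      and 2: "bracket X Y \<rhd> (f * k) = f * (bracket X Y \<rhd> k) + k * (bracket X Y \<rhd> f)"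
      if "f \<in> smooth_functions A" "k \<in> smooth_functions A" for f k
      using that by (simp_all add: app add mult sm algebra_simps)
    have 3: "bracket X Y \<rhd> (\<lambda>x. c * f x) = (\<lambda>x. c * (bracket X Y \<rhd> f) x)"
      if "f \<in> smooth_functions A" for f c
      using that cm(1)[of "Y \<rhd> f" c] cm(2)[of "X \<rhd> f" c]
      by (simp add: app cm(1,2)[OF that] fun_eq_iff algebra_simps)
    have 4: "bracket X Y p f = 0" if "f \<notin> smooth_functions A" for f
    proof -
      have "X \<rhd> f = (\<lambda>x. 0)" "Y \<rhd> f = (\<lambda>x. 0)"
        using that tangentD(4)[OF vector_fieldD(1)[OF X]] tangentD(4)[OF vector_fieldD(1)[OF Y]]
        by (auto simp: vf_apply_def)
      then show ?thesis
        using tangent_const[OF vector_fieldD(1)[OF X]] tangent_const[OF vector_fieldD(1)[OF Y]]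
        by (simp add: bracket_def)
    qed
    show ?thesis unfolding tangent_space_def
      using 1 2 3 4 by (auto simp: pt plus_fun_def times_fun_def)
  qed
  show ?thesis using tan smooth_diff[OF at] by (auto simp: vector_fields_def app)
qed

lemma bracket_antisym: "bracket Y X = - bracket X Y"
  by (simp add: bracket_def fun_eq_iff)

lemma jacobi:
  assumes at: "smooth_atlas A"
    and X: "X \<in> vector_fields A" and Y: "Y \<in> vector_fields A" and Z: "Z \<in> vector_fields A"
  shows "bracket X (bracket Y Z) + bracket Y (bracket Z X) + bracket Z (bracket X Y) = 0"
proof -
  have app: "bracket U W \<rhd> f = U \<rhd> (W \<rhd> f) - W \<rhd> (U \<rhd> f)" for U W :: "'a vector_field" and f
    by (simp add: vf_apply_def bracket_def fun_eq_iff)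
  have diff: "U \<rhd> (f - k) = U \<rhd> f - U \<rhd> k"
    if "U \<in> vector_fields A" "f \<in> smooth_functions A" "k \<in> smooth_functions A" for U f k
    using that tangent_diff[OF at vector_fieldD(1)] by (auto simp: vf_apply_def fun_eq_iff)
  have zero: "U \<rhd> f = 0" if "U \<in> vector_fields A" "f \<notin> smooth_functions A" for U f
    using that tangentD(4)[OF vector_fieldD(1)] by (auto simp: vf_apply_def fun_eq_iff)
  have "(bracket X (bracket Y Z) + bracket Y (bracket Z X) + bracket Z (bracket X Y)) p f = 0" for p f
  proof (cases "f \<in> smooth_functions A")
    case True
    note [simp] = vector_fieldD(2)[OF X] vector_fieldD(2)[OF Y] vector_fieldD(2)[OF Z]
    have "bracket X (bracket Y Z) \<rhd> f + bracket Y (bracket Z X) \<rhd> f + bracket Z (bracket X Y) \<rhd> f = 0"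
      using True X Y Z by (simp add: app diff algebra_simps)
    then show ?thesis by (simp add: vf_apply_def fun_eq_iff)
  next
    case False
    then have "U p f = 0" if "U \<in> vector_fields A" for U
      using zero[OF that] by (auto simp: vf_apply_def fun_eq_iff)
    from this[of "bracket X (bracket Y Z)"] this[of "bracket Y (bracket Z X)"]
      this[of "bracket Z (bracket X Y)"]
    show ?thesis using X Y Z at by (simp add: bracket_vector_field)
  qed
  then show ?thesis by (simp add: fun_eq_iff)
qed

section \<open>Curvature of metric torsion-free connections on involutive distributions\<close>

text \<open>
  The octahedron argument: adding the first Bianchi identities of the four cyclic rotations of
  \<open>(X, Y, Z, W)\<close> with suitable signs, the mixed terms cancel.
\<close>
lemma pair_symmetry:
  fixes K :: "'v \<Rightarrow> 'v \<Rightarrow> 'v \<Rightarrow> 'v \<Rightarrow> real"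
  assumes skew12: "\<And>X Y Z W. \<lbrakk>X \<in> V; Y \<in> V; Z \<in> V; W \<in> V\<rbrakk> \<Longrightarrow> K X Y Z W = - K Y X Z W"
    and skew34: "\<And>X Y Z W. \<lbrakk>X \<in> V; Y \<in> V; Z \<in> V; W \<in> V\<rbrakk> \<Longrightarrow> K X Y Z W = - K X Y W Z"
    and bianchi: "\<And>X Y Z W. \<lbrakk>X \<in> V; Y \<in> V; Z \<in> V; W \<in> V\<rbrakk> \<Longrightarrow>
      K X Y Z W + K Y Z X W + K Z X Y W = 0"
    and V: "X \<in> V" "Y \<in> V" "Z \<in> V" "W \<in> V"
  shows "K X Y Z W = K Z W X Y"
proof -
  note b = bianchi[OF V] bianchi[OF V(2,3,4,1)] bianchi[OF V(3,4,1,2)] bianchi[OF V(4,1,2,3)]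
  note s = skew34[OF V(2,3,4,1)] skew34[OF V(3,4,2,1)] skew34[OF V(1,2,4,3)] skew34[OF V(4,1,3,2)]
    skew34[OF V(1,3,4,2)] skew12[OF V(1,3,2,4)] skew34[OF V(4,2,3,1)] skew12[OF V(4,2,1,3)]
  from b s show ?thesis by linarith
qed

text \<open>
  The module \<open>V\<close> stands for the sections of an involutive distribution, and \<open>nab\<close> for the
  Levi-Civita connections of its leaves. Both the whole tangent bundle and the horizontal
  distribution are instances, so that the symmetries of the curvature are proved once.
\<close>
locale metric_connection_on =
  fixes A :: "('a::{t2_space, second_countable_topology}, 'e::euclidean_space) atlas"
    and V :: "'a vector_field set"
    and g :: "'a vector_field \<Rightarrow> 'a vector_field \<Rightarrow> 'a \<Rightarrow> real"
    and nab :: "'a vector_field \<Rightarrow> 'a vector_field \<Rightarrow> 'a vector_field"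
  assumes atlas: "smooth_atlas A"
    and metric: "riemannian_metric A g"
    and V_vector_field: "X \<in> V \<Longrightarrow> X \<in> vector_fields A"
    and V_add [simp]: "X \<in> V \<Longrightarrow> Y \<in> V \<Longrightarrow> X + Y \<in> V"
    and V_scale [simp]: "f \<in> smooth_functions A \<Longrightarrow> X \<in> V \<Longrightarrow> f \<odot> X \<in> V"
    and V_bracket [simp]: "X \<in> V \<Longrightarrow> Y \<in> V \<Longrightarrow> bracket X Y \<in> V"
    and V_nab [simp]: "X \<in> V \<Longrightarrow> Y \<in> V \<Longrightarrow> nab X Y \<in> V"
    and nab_add_left [simp]:
      "\<lbrakk>X \<in> V; Y \<in> V; Z \<in> V\<rbrakk> \<Longrightarrow> nab (X + Y) Z = nab X Z + nab Y Z"
    and nab_add_right [simp]: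
      "\<lbrakk>X \<in> V; Y \<in> V; Z \<in> V\<rbrakk> \<Longrightarrow> nab X (Y + Z) = nab X Y + nab X Z"
    and nab_leibniz: "\<lbrakk>f \<in> smooth_functions A; X \<in> V; Y \<in> V\<rbrakk> \<Longrightarrow>
      nab X (f \<odot> Y) = (X \<rhd> f) \<odot> Y + f \<odot> nab X Y"
    and torsion_free: "\<lbrakk>X \<in> V; Y \<in> V\<rbrakk> \<Longrightarrow> nab X Y - nab Y X = bracket X Y"
    and compat: "\<lbrakk>X \<in> V; Y \<in> V; Z \<in> V\<rbrakk> \<Longrightarrow> X \<rhd> g Y Z = g (nab X Y) Z + g Y (nab X Z)"
begin

lemma V_uminus [simp]: "X \<in> V \<Longrightarrow> - X \<in> V"
  using V_scale[OF smooth_uminus[OF atlas smooth_one], of X] by (simp add: vf_scale_simps)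

lemma V_diff [simp]: "X \<in> V \<Longrightarrow> Y \<in> V \<Longrightarrow> X - Y \<in> V"
  using V_add[OF _ V_uminus] by fastforce

lemma metric_smooth [simp]: "X \<in> V \<Longrightarrow> Y \<in> V \<Longrightarrow> g X Y \<in> smooth_functions A"
  using metric V_vector_field by (simp add: riemannian_metric_def one_form_def)

lemma metric_sym: "X \<in> V \<Longrightarrow> Y \<in> V \<Longrightarrow> g X Y = g Y X"
  using metric V_vector_field by (simp add: riemannian_metric_def)

lemma metric_add [simp]:
  assumes "X \<in> V" "Y \<in> V" "Z \<in> V"
  shows "g Z (X + Y) = g Z X + g Z Y" "g (X + Y) Z = g X Z + g Y Z"
proof -
  show r: "g Z (X + Y) = g Z X + g Z Y"
    using metric assms V_vector_field by (simp add: riemannian_metric_def one_form_def)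
  show "g (X + Y) Z = g X Z + g Y Z"
    using r assms by (metis V_add metric_sym)
qed

lemma metric_scale [simp]:
  assumes "f \<in> smooth_functions A" "X \<in> V" "Z \<in> V"
  shows "g Z (f \<odot> X) = f * g Z X" "g (f \<odot> X) Z = f * g X Z"
proof -
  show r: "g Z (f \<odot> X) = f * g Z X"
    using metric assms V_vector_field by (simp add: riemannian_metric_def one_form_def)
  show "g (f \<odot> X) Z = f * g X Z"
    using r assms by (metis V_scale metric_sym)
qed

lemma metric_uminus [simp]:
  assumes "X \<in> V" "Z \<in> V"
  shows "g Z (- X) = - g Z X" "g (- X) Z = - g X Z"
  using metric_scale[OF smooth_uminus[OF atlas smooth_one] assms] by (simp_all add: vf_scale_simps)

lemma metric_diff [simp]:
  assumes "X \<in> V" "Y \<in> V" "Z \<in> V"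
  shows "g Z (X - Y) = g Z X - g Z Y" "g (X - Y) Z = g X Z - g Y Z"
  using metric_add[of X "- Y" Z] assms by simp_all

lemma metric_eqI:
  assumes "X \<in> V" "Y \<in> V" "\<And>Z p. Z \<in> V \<Longrightarrow> g X Z p = g Y Z p"
  shows "X = Y"
proof (rule ccontr)
  assume "X \<noteq> Y"
  then obtain p where "(X - Y) p \<noteq> 0" by (auto simp: fun_eq_iff)
  moreover have "X - Y \<in> vector_fields A" using assms V_vector_field by simp
  ultimately have "g (X - Y) (X - Y) p > 0"
    using metric by (auto simp: riemannian_metric_def)
  then show False using assms by (simp del: fun_diff_def)
qed

lemma metric_zero [simp]: "Z \<in> V \<Longrightarrow> g 0 Z = 0" "Z \<in> V \<Longrightarrow> g Z 0 = 0"
  using metric_diff[of Z Z Z] by simp_all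

lemma metric_eq_zeroI:
  assumes "X \<in> V" "\<And>Z p. Z \<in> V \<Longrightarrow> g X Z p = 0"
  shows "X = 0"
  using metric_eqI[of X 0] V_diff[OF assms(1,1)] assms by simp

lemma nab_uminus [simp]:
  assumes "X \<in> V" "Y \<in> V"
  shows "nab (- X) Y = - nab X Y" "nab X (- Y) = - nab X Y"
proof -
  have 0: "0 \<in> V" using V_diff[OF assms(1,1)] by simp
  have "nab 0 Y = 0" "nab X 0 = 0"
    using nab_add_left[OF 0 0 assms(2)] nab_add_right[OF assms(1) 0 0] by simp_all
  then show "nab (- X) Y = - nab X Y" "nab X (- Y) = - nab X Y"
    using nab_add_left[OF assms(1) V_uminus[OF assms(1)] assms(2)]
      nab_add_right[OF assms V_uminus[OF assms(2)]]
    by (simp_all add: eq_neg_iff_add_eq_0 add.commute)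
qed

lemma nab_diff [simp]:
  assumes "X \<in> V" "Y \<in> V" "Z \<in> V"
  shows "nab (X - Y) Z = nab X Z - nab Y Z" "nab X (Y - Z) = nab X Y - nab X Z"
  using nab_add_left[of X "- Y" Z] nab_add_right[of X Y "- Z"] assms by simp_all

lemma curvature_V [simp]: "\<lbrakk>X \<in> V; Y \<in> V; Z \<in> V\<rbrakk> \<Longrightarrow> curvature nab X Y Z \<in> V"
  by (simp add: curvature_def)

lemma curvature_skew: "\<lbrakk>X \<in> V; Y \<in> V; Z \<in> V\<rbrakk> \<Longrightarrow> curvature nab X Y Z = - curvature nab Y X Z"
  unfolding curvature_def by (subst bracket_antisym) simp

lemma deriv_add:
  "\<lbrakk>X \<in> V; f \<in> smooth_functions A; k \<in> smooth_functions A\<rbrakk> \<Longrightarrow> X \<rhd> (f + k) = X \<rhd> f + X \<rhd> k"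
  using tangentD(1)[OF vector_fieldD(1)[OF V_vector_field]] by (auto simp: vf_apply_def fun_eq_iff)

text \<open>
  Both sides of \<open>[X,Y] g(Z,W) = X (Y g(Z,W)) - Y (X g(Z,W))\<close> are expanded by compatibility of
  the connection with the metric.
\<close>
lemma curvature_metric_skew:
  assumes V: "X \<in> V" "Y \<in> V" "Z \<in> V" "W \<in> V"
  shows "g (curvature nab X Y Z) W = - g (curvature nab X Y W) Z"
proof -
  have "bracket X Y \<rhd> g Z W = X \<rhd> (Y \<rhd> g Z W) - Y \<rhd> (X \<rhd> g Z W)"
    by (simp add: vf_apply_def bracket_def fun_eq_iff)
  moreover have "X \<rhd> (Y \<rhd> g Z W) = g (nab X (nab Y Z)) W + g (nab Y Z) (nab X W)
      + g (nab X Z) (nab Y W) + g Z (nab X (nab Y W))"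
    using V by (simp add: compat deriv_add algebra_simps)
  moreover have "Y \<rhd> (X \<rhd> g Z W) = g (nab Y (nab X Z)) W + g (nab X Z) (nab Y W)
      + g (nab Y Z) (nab X W) + g Z (nab Y (nab X W))"
    using V by (simp add: compat deriv_add algebra_simps)
  moreover have "bracket X Y \<rhd> g Z W = g (nab (bracket X Y) Z) W + g Z (nab (bracket X Y) W)"
    using V by (simp add: compat)
  ultimately have "g (curvature nab X Y Z) W = - g Z (curvature nab X Y W)"
    using V by (simp add: curvature_def algebra_simps)
  then show ?thesis using V by (simp add: metric_sym[of Z])
qed

lemma first_bianchi:
  assumes V: "X \<in> V" "Y \<in> V" "Z \<in> V"
  shows "curvature nab X Y Z + curvature nab Y Z X + curvature nab Z X Y = 0"
proof -
  have br: "bracket U (bracket P Q) = nab U (nab P Q) - nab U (nab Q P) - nab (bracket P Q) U"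
    if "U \<in> V" "P \<in> V" "Q \<in> V" for U P Q
    using that torsion_free[of U "bracket P Q"] torsion_free[of P Q]
    by (metis V_bracket V_nab nab_diff(2))
  then show ?thesis
    using jacobi[OF atlas V[THEN V_vector_field]] br[OF V] br[OF V(2,3,1)] br[OF V(3,1,2)]
    by (simp add: curvature_def algebra_simps)
qed

lemma curvature_pair:
  assumes "X \<in> V" "Y \<in> V" "Z \<in> V" "W \<in> V"
  shows "g (curvature nab X Y Z) W p = g (curvature nab Z W X) Y p"
proof (rule pair_symmetry[where V = V, OF _ _ _ assms])
  fix X Y Z W assume V: "X \<in> V" "Y \<in> V" "Z \<in> V" "W \<in> V"
  show "g (curvature nab X Y Z) W p = - g (curvature nab Y X Z) W p"
    using V curvature_skew[of X Y Z] by simp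
  show "g (curvature nab X Y Z) W p = - g (curvature nab X Y W) Z p"
    using curvature_metric_skew[OF V] by simp
  have "g (curvature nab X Y Z) W + g (curvature nab Y Z X) W + g (curvature nab Z X Y) W
      = g (curvature nab X Y Z + curvature nab Y Z X + curvature nab Z X Y) W"
    using V by simp
  also have "\<dots> = 0" using V by (simp add: first_bianchi)
  finally show "g (curvature nab X Y Z) W p + g (curvature nab Y Z X) W p
      + g (curvature nab Z X Y) W p = 0" by (metis plus_fun_apply zero_fun_apply)
qed

end

section \<open>Flatness of split almost Kaehler leaves\<close>

text \<open>
  An almost Kaehler structure \<open>(g, \<phi>)\<close> on the leaves together with a symmetric operator \<open>H\<close> that
  satisfies the Codazzi equation and anticommutes with \<open>\<phi>\<close>. As \<open>H\<^sup>2 = c\<close> with \<open>c\<close> nowhere zero and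
  constant along the leaves, the eigenspaces of \<open>H\<close> have constant eigenvalues \<open>\<plusminus>\<surd>c\<close> and are
  interchanged by \<open>\<phi>\<close>.
\<close>
locale split_almost_kaehler = metric_connection_on A V g nab
  for A :: "('a::{t2_space, second_countable_topology}, 'e::euclidean_space) atlas"
    and V :: "'a vector_field set"
    and g :: "'a vector_field \<Rightarrow> 'a vector_field \<Rightarrow> 'a \<Rightarrow> real"
    and nab :: "'a vector_field \<Rightarrow> 'a vector_field \<Rightarrow> 'a vector_field" +
  fixes H \<phi> :: "'a vector_field \<Rightarrow> 'a vector_field"
    and c :: "'a \<Rightarrow> real"
  assumes H_V [simp]: "X \<in> V \<Longrightarrow> H X \<in> V"
    and H_add: "X \<in> V \<Longrightarrow> Y \<in> V \<Longrightarrow> H (X + Y) = H X + H Y"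
    and H_sym: "X \<in> V \<Longrightarrow> Y \<in> V \<Longrightarrow> g (H X) Y = g X (H Y)"
    and H_sq: "X \<in> V \<Longrightarrow> H (H X) = c \<odot> X"
    and c_smooth [simp]: "c \<in> smooth_functions A"
    and c_nz: "c p \<noteq> 0"
    and c_const: "X \<in> V \<Longrightarrow> X \<rhd> c = 0"
    and codazzi: "X \<in> V \<Longrightarrow> Y \<in> V \<Longrightarrow> nab X (H Y) - nab Y (H X) = H (bracket X Y)"
    and \<phi>_V [simp]: "X \<in> V \<Longrightarrow> \<phi> X \<in> V"
    and \<phi>_add: "X \<in> V \<Longrightarrow> Y \<in> V \<Longrightarrow> \<phi> (X + Y) = \<phi> X + \<phi> Y"
    and \<phi>_skew: "X \<in> V \<Longrightarrow> Y \<in> V \<Longrightarrow> g (\<phi> X) Y = - g X (\<phi> Y)"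
    and \<phi>_sq: "X \<in> V \<Longrightarrow> \<phi> (\<phi> X) = - X"
    and H_\<phi>: "X \<in> V \<Longrightarrow> H (\<phi> X) = - \<phi> (H X)"
    and closed: "\<lbrakk>X \<in> V; Y \<in> V; Z \<in> V\<rbrakk> \<Longrightarrow> d_two_form (fundamental_form \<phi> g) X Y Z = 0"
begin

lemma additive_diff:
  assumes "\<And>X Y. X \<in> V \<Longrightarrow> Y \<in> V \<Longrightarrow> F (X + Y) = F X + F Y" "X \<in> V" "Y \<in> V"
  shows "F (X - Y) = F X - (F Y :: 'a vector_field)" "F (- X) = - F X"
proof -
  have d: "F (U - W) = F U - F W" if "U \<in> V" "W \<in> V" for U W
    using assms(1)[of "U - W" W] that by simp
  then show "F (X - Y) = F X - F Y" using assms by simp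
  have "F 0 = 0" using d[OF assms(2,2)] by simp
  then show "F (- X) = - F X" using d[OF V_diff[OF assms(2,2)] assms(2)] by simp
qed

lemmas H_diff = additive_diff[where F = H, OF H_add]
lemmas \<phi>_diff = additive_diff[where F = \<phi>, OF \<phi>_add]

text \<open>
  The tensor \<open>g((\<nabla>\<^sub>X H)Y, Z)\<close> is totally symmetric, by the Codazzi equation and the symmetry of
  \<open>H\<close>. Since \<open>H\<^sup>2\<close> is parallel, moving \<open>H\<close> from \<open>Y\<close> to \<open>Z\<close> changes the sign. Moving it once around
  the three arguments gives three sign changes but returns to the start, so the tensor vanishes
  wherever an argument lies in the image of \<open>H\<close>, that is, everywhere.
\<close>
lemma H_parallel:
  assumes V: "X \<in> V" "Y \<in> V"
  shows "nab X (H Y) = H (nab X Y)"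
proof -
  define N where "N X Y = nab X (H Y) - H (nab X Y)" for X Y
  have N_V [simp]: "N X Y \<in> V" if "X \<in> V" "Y \<in> V" for X Y
    using that by (simp add: N_def)
  have N_sym: "N X Y = N Y X" if "X \<in> V" "Y \<in> V" for X Y
    using that codazzi[OF that] torsion_free[OF that, symmetric] H_diff(1)[of "nab X Y" "nab Y X"]
    by (simp add: N_def algebra_simps)
  have N_self: "g (N X Y) Z = g (N X Z) Y" if "X \<in> V" "Y \<in> V" "Z \<in> V" for X Y Z
  proof -
    have "X \<rhd> g (H Y) Z = X \<rhd> g Y (H Z)" using that by (simp add: H_sym)
    then have "g (nab X (H Y)) Z + g (H Y) (nab X Z) = g (nab X Y) (H Z) + g Y (nab X (H Z))"
      using that by (simp add: compat)
    moreover have "g (H Y) (nab X Z) = g Y (H (nab X Z))" "g (H (nab X Y)) Z = g (nab X Y) (H Z)"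
      using that by (simp_all add: H_sym)
    ultimately have "g (N X Y) Z = g Y (N X Z)"
      using that unfolding N_def by (simp add: algebra_simps)
    also have "\<dots> = g (N X Z) Y" using that by (intro metric_sym) simp_all
    finally show ?thesis .
  qed
  have N_H: "N X (H Y) = - H (N X Y)" if "X \<in> V" "Y \<in> V" for X Y
  proof -
    have "nab X (H (H Y)) = H (H (nab X Y))"
      using that by (simp add: H_sq nab_leibniz c_const vf_scale_simps)
    then show ?thesis using that by (simp add: N_def H_diff)
  qed
  have shift: "g (N X (H Y)) Z = - g (N X Y) (H Z)" if "X \<in> V" "Y \<in> V" "Z \<in> V" for X Y Z
    using that by (simp add: N_H H_sym)
  have zero: "g (N X (H Y)) Z p = 0" if W: "X \<in> V" "Y \<in> V" "Z \<in> V" for X Y Z p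
  proof -
    have 1: "g (N X (H Y)) Z p = - g (N X Y) (H Z) p"
      if "X \<in> V" "Y \<in> V" "Z \<in> V" for X Y Z using shift[OF that] by simp
    have 2: "g (N X Y) (H Z) p = g (N Y (H Z)) X p"
      if "X \<in> V" "Y \<in> V" "Z \<in> V" for X Y Z
      using that N_self[of Y X "H Z"] N_sym[of X Y] by simp
    show ?thesis
      using 1[OF W] 2[OF W] 1[OF W(2,3,1)] 2[OF W(2,3,1)] 1[OF W(3,1,2)] 2[OF W(3,1,2)]
      by linarith
  qed
  have "N X Y = 0"
  proof (rule metric_eq_zeroI)
    fix Z p assume Z: "Z \<in> V"
    \<comment> \<open>\<open>H\<close> is invertible because \<open>c\<close> vanishes nowhere, so it may be inserted before \<open>Z\<close>.\<close>
    have "g (N X (H Y)) (H Z) = - (c * g (N X Y) Z)"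
      using V Z shift[of X Y "H Z"] by (simp add: H_sq)
    then have "c p * g (N X Y) Z p = 0"
      using zero[of X Y "H Z" p] V Z by simp
    then show "g (N X Y) Z p = 0" using c_nz by simp
  qed (use V in simp)
  then show ?thesis by (simp add: N_def)
qed

text \<open>
  Let \<open>M = \<nabla>\<phi>\<close> and \<open>C(X,Y,Z) = g(M\<^sub>X Y, \<phi> Z)\<close>, which is skew in \<open>Y, Z\<close>. Closedness of the
  fundamental form makes the cyclic sum of \<open>g(M\<^sub>X Y, Z)\<close> zero. Because \<open>M\<close> anticommutes with the
  parallel operator \<open>H\<close>, the expression \<open>C(HX,HY,Z) + c C(X,Y,Z)\<close> is symmetric in \<open>X, Y\<close>; being
  skew in \<open>Y, Z\<close> as well, it is zero. Replacing \<open>Y, Z\<close> by \<open>\<phi> Y, \<phi> Z\<close> changes the sign of the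
  second summand only, hence \<open>c C = 0\<close>.
\<close>
lemma \<phi>_parallel:
  assumes V: "X \<in> V" "Y \<in> V"
  shows "nab X (\<phi> Y) = \<phi> (nab X Y)"
proof -
  define M where "M X Y = nab X (\<phi> Y) - \<phi> (nab X Y)" for X Y
  have M_V [simp]: "M X Y \<in> V" if "X \<in> V" "Y \<in> V" for X Y
    using that by (simp add: M_def)
  have skew: "g (M X Y) Z = - g (M X Z) Y" if "X \<in> V" "Y \<in> V" "Z \<in> V" for X Y Z
  proof -
    have "g (\<phi> Y) Z = g (\<phi> Z) (- Y)"
      using that metric_sym[of Y "\<phi> Z"] by (simp add: \<phi>_skew)
    then have "g (nab X (\<phi> Y)) Z + g (\<phi> Y) (nab X Z) = g (nab X (\<phi> Z)) (- Y) + g (\<phi> Z) (nab X (- Y))"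
      using that compat[of X "\<phi> Y" Z] compat[of X "\<phi> Z" "- Y"]
      by (simp only: \<phi>_V V_uminus)
    then have "g (nab X (\<phi> Y)) Z + g (\<phi> Y) (nab X Z) = - g (nab X (\<phi> Z)) Y - g (\<phi> Z) (nab X Y)"
      using that by simp
    moreover have "g (\<phi> (nab X Y)) Z = - g (\<phi> Z) (nab X Y)" "g (\<phi> (nab X Z)) Y = - g (\<phi> Y) (nab X Z)"
      using that \<phi>_skew[of "nab X Y" Z] metric_sym[of "nab X Y" "\<phi> Z"]
        \<phi>_skew[of "nab X Z" Y] metric_sym[of "nab X Z" "\<phi> Y"] by simp_all
    ultimately show ?thesis
      using that by (simp add: M_def) (simp add: eq_neg_iff_add_eq_0 algebra_simps)
  qed
  have M_\<phi>: "M X (\<phi> Y) = - \<phi> (M X Y)" if "X \<in> V" "Y \<in> V" for X Y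
    using that by (simp add: M_def \<phi>_diff \<phi>_sq)
  have M_H: "M X (H Y) = - H (M X Y)" if "X \<in> V" "Y \<in> V" for X Y
  proof -
    have "nab X (\<phi> (H Y)) = - H (nab X (\<phi> Y))"
      using that H_parallel[of X "\<phi> Y"] nab_uminus(2)[of X "H (\<phi> Y)"] by (simp add: H_\<phi>)
    then show ?thesis using that by (simp add: M_def H_diff H_\<phi> H_parallel)
  qed
  have cyclic: "g (M X Y) Z p + g (M Y Z) X p + g (M Z X) Y p = 0"
    if W: "X \<in> V" "Y \<in> V" "Z \<in> V" for X Y Z p
  proof -
    have d: "U \<rhd> fundamental_form \<phi> g P Q
        = g (nab U P) (\<phi> Q) + g (M U Q) P + g P (\<phi> (nab U Q))"
      if "U \<in> V" "P \<in> V" "Q \<in> V" for U P Q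
      using that metric_sym[of P "nab U (\<phi> Q)"] metric_sym[of P "\<phi> (nab U Q)"]
      by (simp add: fundamental_form_def compat M_def)
    have b: "fundamental_form \<phi> g (bracket P Q) U = g (nab P Q) (\<phi> U) - g (nab Q P) (\<phi> U)"
      if "U \<in> V" "P \<in> V" "Q \<in> V" for U P Q
      using that by (simp add: fundamental_form_def torsion_free[symmetric] fun_eq_iff)
    have e: "g P (\<phi> (nab U Q)) = - g (nab U Q) (\<phi> P)" if "U \<in> V" "P \<in> V" "Q \<in> V" for U P Q
      using that by (metis V_nab \<phi>_V \<phi>_skew metric_sym)
    have "g (M X Z) Y - g (M Y Z) X + g (M Z Y) X = 0"
      using closed[OF W] W by (simp add: d_two_form_def d b e algebra_simps)
    then have "g (M X Z) Y p - g (M Y Z) X p + g (M Z Y) X p = 0"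
      by (metis fun_diff_def plus_fun_apply zero_fun_apply)
    then show ?thesis using skew[of X Y Z] skew[of Y Z X] skew[of Z X Y] W by simp
  qed
  define C where "C X Y Z p = g (M X Y) (\<phi> Z) p" for X Y Z p
  have C_skew: "C X Y Z p = - C X Z Y p" if "X \<in> V" "Y \<in> V" "Z \<in> V" for X Y Z p
  proof -
    have "g (M X Y) (\<phi> Z) = - g (M X (\<phi> Z)) Y" using that by (simp add: skew[of X Y "\<phi> Z"])
    also have "\<dots> = - g (M X Z) (\<phi> Y)" using that by (simp add: M_\<phi> \<phi>_skew)
    finally show ?thesis by (simp add: C_def)
  qed
  have C_H: "C X (H Y) Z p = C X Y (H Z) p" if "X \<in> V" "Y \<in> V" "Z \<in> V" for X Y Z p
    using that by (simp add: C_def M_H H_sym H_\<phi>)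
  have C_c: "C X Y (H (H Z)) p = c p * C X Y Z p" if "X \<in> V" "Y \<in> V" "Z \<in> V" for X Y Z p
  proof -
    have "\<phi> (H (H Z)) = H (H (\<phi> Z))" using that by (simp add: H_\<phi> H_diff)
    then show ?thesis using that by (simp add: C_def H_sq)
  qed
  have C_\<phi>: "C X (\<phi> Y) (\<phi> Z) p = - C X Y Z p" if "X \<in> V" "Y \<in> V" "Z \<in> V" for X Y Z p
    using that by (simp add: C_def M_\<phi> \<phi>_skew \<phi>_sq)
  have D_sym: "C (H X) (H Y) Z p + c p * C X Y Z p = C (H Y) (H X) Z p + c p * C Y X Z p"
    if W: "X \<in> V" "Y \<in> V" "Z \<in> V" for X Y Z p
  proof -
    have 1: "C U W Z p - C W U Z p = - g (M (\<phi> Z) U) W p" if "U \<in> V" "W \<in> V" for U W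
      using that W cyclic[of U W "\<phi> Z" p] skew[of W "\<phi> Z" U] by (simp add: C_def)
    have "g (M (\<phi> Z) (H X)) (H Y) = - (c * g (M (\<phi> Z) X) Y)"
      using W by (simp add: M_H H_sym H_sq)
    moreover have "c p * (C X Y Z p - C Y X Z p) = - (c p * g (M (\<phi> Z) X) Y p)"
      using 1[of X Y] W by simp
    ultimately show ?thesis using 1[of "H X" "H Y"] W by (simp add: algebra_simps)
  qed
  have D_skew: "C (H X) (H Y) Z p + c p * C X Y Z p = - (C (H X) (H Z) Y p + c p * C X Z Y p)"
    if W: "X \<in> V" "Y \<in> V" "Z \<in> V" for X Y Z p
    using W C_skew[of X Y Z p] C_skew[of "H X" Y "H Z" p] C_H[of "H X" Y Z p] by simp
  \<comment> \<open>A trilinear form that is symmetric in one pair and skew in an overlapping pair is zero.\<close>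
  have D: "C (H X) (H Y) Z p + c p * C X Y Z p = 0"
    if W: "X \<in> V" "Y \<in> V" "Z \<in> V" for X Y Z p
    using D_sym[OF W, of p] D_sym[OF W(2,3,1), of p] D_sym[OF W(3,1,2), of p]
      D_skew[OF W, of p] D_skew[OF W(2,3,1), of p] D_skew[OF W(3,1,2), of p] by linarith
  have C_0: "C X Y Z p = 0" if W: "X \<in> V" "Y \<in> V" "Z \<in> V" for X Y Z p
  proof -
    have "C (H X) (H (\<phi> Y)) (\<phi> Z) p = C (H X) (H Y) Z p"
      using W C_\<phi>[of "H X" "H Y" Z p] by (simp add: H_\<phi> C_def M_def \<phi>_diff)
    then have "c p * C X Y Z p = 0"
      using D[OF W, of p] D[of X "\<phi> Y" "\<phi> Z" p] C_\<phi>[OF W, of p] W by simp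
    then show ?thesis using c_nz by simp
  qed
  show ?thesis
  proof (rule metric_eqI)
    show "g (nab X (\<phi> Y)) Z p = g (\<phi> (nab X Y)) Z p" if "Z \<in> V" for Z p
      using C_0[of X Y "\<phi> Z" p] V that by (simp add: C_def \<phi>_sq M_def)
  qed (use V in simp_all)
qed

text \<open>
  The curvature commutes with the parallel operators \<open>H\<close> and \<open>\<phi>\<close>. By pair symmetry and the Bianchi
  identity, \<open>K(HX,Y,Z,W) - K(X,Y,HZ,W)\<close> is skew in \<open>X, Y\<close> and symmetric in \<open>Y, Z\<close>, so it is zero: this
  is the product structure. Conjugating \<open>Z, W\<close> by \<open>\<phi>\<close> preserves \<open>K\<close> but changes the sign of \<open>H\<close>,
  which gives \<open>K(HX,Y,Z,W) = - K(HX,Y,Z,W)\<close>.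
\<close>
theorem flat:
  assumes V: "X \<in> V" "Y \<in> V" "Z \<in> V"
  shows "curvature nab X Y Z = 0"
proof -
  define K where "K X Y Z W p = g (curvature nab X Y Z) W p" for X Y Z W p
  have R_H: "curvature nab X Y (H Z) = H (curvature nab X Y Z)"
    and R_\<phi>: "curvature nab X Y (\<phi> Z) = \<phi> (curvature nab X Y Z)"
    and R_uminus: "curvature nab X Y (- Z) = - curvature nab X Y Z"
    if "X \<in> V" "Y \<in> V" "Z \<in> V" for X Y Z
    using that by (simp_all add: curvature_def H_parallel \<phi>_parallel H_diff \<phi>_diff)
  have pair: "K X Y Z W p = K Z W X Y p" and skew: "K X Y Z W p = - K Y X Z W p"
    and H34: "K X Y (H Z) W p = K X Y Z (H W) p" and \<phi>34: "K X Y (\<phi> Z) W p = - K X Y Z (\<phi> W) p"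
    if "X \<in> V" "Y \<in> V" "Z \<in> V" "W \<in> V" for X Y Z W p
    using that curvature_pair[of X Y Z W p] curvature_skew[of X Y Z]
    by (simp_all add: K_def R_H R_\<phi> H_sym \<phi>_skew)
  have H12: "K (H X) Y Z W p = K X (H Y) Z W p"
    if "X \<in> V" "Y \<in> V" "Z \<in> V" "W \<in> V" for X Y Z W p
    using that pair[of "H X" Y Z W p] pair[of X "H Y" Z W p] H34[of Z W X Y p] by simp
  have bianchi: "K X Y Z W p + K Y Z X W p + K Z X Y W p = 0"
    if "X \<in> V" "Y \<in> V" "Z \<in> V" "W \<in> V" for X Y Z W p
  proof -
    have "K X Y Z W p + K Y Z X W p + K Z X Y W p
      = g (curvature nab X Y Z + curvature nab Y Z X + curvature nab Z X Y) W p"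
      using that by (simp add: K_def)
    also have "\<dots> = 0" using that by (simp add: first_bianchi)
    finally show ?thesis .
  qed
  have H13: "K (H X) Y Z W p = K X Y (H Z) W p"
    if W: "X \<in> V" "Y \<in> V" "Z \<in> V" "W \<in> V" for X Y Z W p
  proof -
    define a where "a X Y Z = K (H X) Y Z W p - K X Y (H Z) W p" for X Y Z
    have a_sym: "a P Q U = a P U Q" if P: "P \<in> V" "Q \<in> V" "U \<in> V" for P Q U
      using P W bianchi[of "H P" Q U W p] bianchi[of P Q U "H W" p]
        H34[of P Q U W p] H34[of Q U P W p] H34[of U P Q W p]
        skew[of U "H P" Q W p] skew[of U P "H Q" W p] by (simp add: a_def)
    have a_skew: "a P Q U = - a Q P U" if P: "P \<in> V" "Q \<in> V" "U \<in> V" for P Q U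
      using P W H12[of P Q U W p] skew[of P "H Q" U W p] skew[of P Q "H U" W p] by (simp add: a_def)
    have "a X Y Z = 0"
      using W a_sym[of X Y Z] a_sym[of Y Z X] a_sym[of Z X Y]
        a_skew[of X Y Z] a_skew[of Y Z X] a_skew[of Z X Y] by simp
    then show ?thesis by (simp add: a_def)
  qed
  have K_H: "K (H X) Y Z W p = 0" if W: "X \<in> V" "Y \<in> V" "Z \<in> V" "W \<in> V" for X Y Z W p
  proof -
    have \<phi>\<phi>: "K P Q (\<phi> Z) (\<phi> W) p = K P Q Z W p" if "P \<in> V" "Q \<in> V" "Z \<in> V" for P Q Z
      using that W \<phi>34[of P Q Z "\<phi> W" p] by (simp add: \<phi>_sq K_def)
    have "K (H X) Y Z W p = K (H X) Y (\<phi> Z) (\<phi> W) p" using W \<phi>\<phi> by simp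
    also have "\<dots> = K X Y (H (\<phi> Z)) (\<phi> W) p" using W H13 by simp
    also have "\<dots> = - K X Y (\<phi> (H Z)) (\<phi> W) p" using W by (simp add: H_\<phi> K_def R_uminus)
    also have "\<dots> = - K X Y (H Z) W p" using W \<phi>\<phi> by simp
    also have "\<dots> = - K (H X) Y Z W p" using W H13 by simp
    finally show ?thesis by simp
  qed
  show ?thesis
  proof (rule metric_eq_zeroI)
    fix U p assume U: "U \<in> V"
    have "K X Y Z (H (H U)) p = 0"
      using K_H[of X Y Z "H U" p] H13[of X Y Z "H U" p] H34[of X Y Z "H U" p] V U by simp
    then have "c p * K X Y Z U p = 0" using V U by (simp add: K_def H_sq)
    then show "g (curvature nab X Y Z) U p = 0" using c_nz by (simp add: K_def)
  qed (use V in simp)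
qed

end

section \<open>The structure operators of an almost Kenmotsu manifold\<close>

lemma double_eq_zeroD: "X + X = 0 \<Longrightarrow> X = (0 :: 'a vector_field)"
  by (simp add: fun_eq_iff)

text \<open>
  Stated for the partially applied form, so that it rewrites \<open>d_two_form\<close> and \<open>wedge_12\<close>, which
  take the 2-form itself as an argument.
\<close>
lemma fundamental_form_abs: "fundamental_form \<phi> g = (\<lambda>X Y. g X (\<phi> Y))"
  by (simp add: fundamental_form_def fun_eq_iff)

locale almost_kenmotsu_connection =
  fixes A :: "('a::{t2_space, second_countable_topology}, 'e::euclidean_space) atlas"
    and \<phi> :: "'a vector_field \<Rightarrow> 'a vector_field"
    and \<xi> :: "'a vector_field"
    and \<eta> :: "'a vector_field \<Rightarrow> 'a \<Rightarrow> real"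
    and g :: "'a vector_field \<Rightarrow> 'a vector_field \<Rightarrow> 'a \<Rightarrow> real"
    and nab :: "'a vector_field \<Rightarrow> 'a vector_field \<Rightarrow> 'a vector_field"
  assumes kenmotsu: "almost_kenmotsu A \<phi> \<xi> \<eta> g"
    and levi_civita: "levi_civita A g nab"
begin

abbreviation "\<XX> \<equiv> vector_fields A"

lemma contact_metric: "almost_contact_metric A \<phi> \<xi> \<eta> g"
  using kenmotsu by (simp add: almost_kenmotsu_def)

lemma atlas: "smooth_atlas A" and metric: "riemannian_metric A g"
  using contact_metric by (simp_all add: almost_contact_metric_def)

sublocale metric_connection_on A \<XX> g nab
  using atlas metric levi_civita
  by unfold_locales
    (auto simp: levi_civita_def affine_connection_def tensor_11_def vector_field_add
      vector_field_scale bracket_vector_field)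

lemma nab_scale_left [simp]:
  "\<lbrakk>f \<in> smooth_functions A; X \<in> \<XX>; Y \<in> \<XX>\<rbrakk> \<Longrightarrow> nab (f \<odot> X) Y = f \<odot> nab X Y"
  using levi_civita by (auto simp: levi_civita_def affine_connection_def tensor_11_def)

lemma phi_X [simp]: "X \<in> \<XX> \<Longrightarrow> \<phi> X \<in> \<XX>"
  and phi_add [simp]: "X \<in> \<XX> \<Longrightarrow> Y \<in> \<XX> \<Longrightarrow> \<phi> (X + Y) = \<phi> X + \<phi> Y"
  and phi_scale [simp]: "f \<in> smooth_functions A \<Longrightarrow> X \<in> \<XX> \<Longrightarrow> \<phi> (f \<odot> X) = f \<odot> \<phi> X"
  and xi_X [simp]: "\<xi> \<in> \<XX>"
  and eta_smooth [simp]: "X \<in> \<XX> \<Longrightarrow> \<eta> X \<in> smooth_functions A"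
  and eta_add [simp]: "X \<in> \<XX> \<Longrightarrow> Y \<in> \<XX> \<Longrightarrow> \<eta> (X + Y) = \<eta> X + \<eta> Y"
  and eta_scale [simp]: "f \<in> smooth_functions A \<Longrightarrow> X \<in> \<XX> \<Longrightarrow> \<eta> (f \<odot> X) = f * \<eta> X"
  and eta_xi [simp]: "\<eta> \<xi> = 1"
  and phi_phi: "X \<in> \<XX> \<Longrightarrow> \<phi> (\<phi> X) = - X + \<eta> X \<odot> \<xi>"
  and metric_phi_phi: "X \<in> \<XX> \<Longrightarrow> Y \<in> \<XX> \<Longrightarrow> g (\<phi> X) (\<phi> Y) = g X Y - \<eta> X * \<eta> Y"
  using contact_metric by (simp_all add: almost_contact_metric_def tensor_11_def one_form_def)

lemma phi_uminus [simp]: "X \<in> \<XX> \<Longrightarrow> \<phi> (- X) = - \<phi> X"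
  and eta_uminus [simp]: "X \<in> \<XX> \<Longrightarrow> \<eta> (- X) = - \<eta> X"
  using phi_scale[OF smooth_uminus[OF atlas smooth_one]]
    eta_scale[OF smooth_uminus[OF atlas smooth_one]]
  by (simp_all add: vf_scale_simps)

lemma phi_diff [simp]: "X \<in> \<XX> \<Longrightarrow> Y \<in> \<XX> \<Longrightarrow> \<phi> (X - Y) = \<phi> X - \<phi> Y"
  and eta_diff [simp]: "X \<in> \<XX> \<Longrightarrow> Y \<in> \<XX> \<Longrightarrow> \<eta> (X - Y) = \<eta> X - \<eta> Y"
  using phi_add[of X "- Y"] eta_add[of X "- Y"] by simp_all

lemma phi_zero [simp]: "\<phi> 0 = 0" and eta_zero [simp]: "\<eta> 0 = 0"
  and nab_zero [simp]: "X \<in> \<XX> \<Longrightarrow> nab X 0 = 0"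
  using phi_diff[OF xi_X xi_X] eta_diff[OF xi_X xi_X] nab_diff(2)[OF _ xi_X xi_X] by simp_all

text \<open>
  Computing \<open>\<phi>\<^sup>3 \<xi>\<close> in two ways gives \<open>\<phi> \<xi> = \<eta>(\<phi> \<xi>) \<xi>\<close>; applying \<open>\<phi>\<close> and \<open>\<eta>\<close> once more, the
  factor squares to zero.
\<close>
lemma phi_xi [simp]: "\<phi> \<xi> = 0"
proof -
  let ?f = "\<eta> (\<phi> \<xi>)"
  have "\<phi> (\<phi> \<xi>) = 0" by (simp add: phi_phi vf_scale_simps)
  moreover have "\<phi> (\<phi> (\<phi> \<xi>)) = - \<phi> \<xi> + ?f \<odot> \<xi>" by (rule phi_phi) simp
  ultimately have "- \<phi> \<xi> + ?f \<odot> \<xi> = 0" by simp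
  then have f: "\<phi> \<xi> = ?f \<odot> \<xi>" by (simp only: neg_eq_iff_add_eq_0[symmetric] minus_minus)
  have "\<phi> (\<phi> \<xi>) = ?f \<odot> (?f \<odot> \<xi>)"
    using arg_cong[OF f, of \<phi>] f by (metis eta_smooth phi_X phi_scale xi_X)
  with \<open>\<phi> (\<phi> \<xi>) = 0\<close> have "\<eta> (?f \<odot> (?f \<odot> \<xi>)) = 0" by simp
  then have "?f = 0" by (simp add: fun_eq_iff)
  then show ?thesis using f by (simp add: vf_scale_simps)
qed

lemma metric_xi [simp]: "X \<in> \<XX> \<Longrightarrow> g \<xi> X = \<eta> X" "X \<in> \<XX> \<Longrightarrow> g X \<xi> = \<eta> X"
  using metric_phi_phi[of \<xi> X] metric_sym[of \<xi> X] by simp_all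

lemma eta_phi [simp]: "X \<in> \<XX> \<Longrightarrow> \<eta> (\<phi> X) = 0"
proof -
  assume X: "X \<in> \<XX>"
  have "\<phi> (\<phi> (\<phi> X)) = - \<phi> X + \<eta> (\<phi> X) \<odot> \<xi>" using X by (intro phi_phi) simp
  moreover have "\<phi> (\<phi> (\<phi> X)) = - \<phi> X" using X phi_phi[OF X] by (simp add: vf_scale_simps)
  ultimately have "\<eta> (\<eta> (\<phi> X) \<odot> \<xi>) = 0" by simp
  then show ?thesis using X by simp
qed

lemma phi_skew: "X \<in> \<XX> \<Longrightarrow> Y \<in> \<XX> \<Longrightarrow> g (\<phi> X) Y = - g X (\<phi> Y)"
  using metric_phi_phi[of "\<phi> X" Y] by (simp add: phi_phi)

lemma deriv_const: "X \<in> \<XX> \<Longrightarrow> X \<rhd> 0 = 0" "X \<in> \<XX> \<Longrightarrow> X \<rhd> 1 = 0"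
  using tangent_const[OF vector_fieldD(1)]
  by (auto simp: vf_apply_def fun_eq_iff zero_fun_def one_fun_def)

definition B :: "'a vector_field \<Rightarrow> 'a vector_field"
  where "B X = nab X \<xi>"

text \<open>
  On \<open>ker \<eta>\<close>, this is the shape operator minus the identity; it equals \<open>h \<circ> \<phi>\<close> (see
  \<open>h_tensor_eq\<close> and \<open>H_phi\<close>), but this form makes its symmetry evident.
\<close>
definition H :: "'a vector_field \<Rightarrow> 'a vector_field"
  where "H X = B X - X + \<eta> X \<odot> \<xi>"

lemma B_X [simp]: "X \<in> \<XX> \<Longrightarrow> B X \<in> \<XX>"
  and B_add [simp]: "X \<in> \<XX> \<Longrightarrow> Y \<in> \<XX> \<Longrightarrow> B (X + Y) = B X + B Y"
  and B_uminus [simp]: "X \<in> \<XX> \<Longrightarrow> B (- X) = - B X"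
  and B_diff [simp]: "X \<in> \<XX> \<Longrightarrow> Y \<in> \<XX> \<Longrightarrow> B (X - Y) = B X - B Y"
  and B_scale [simp]: "f \<in> smooth_functions A \<Longrightarrow> X \<in> \<XX> \<Longrightarrow> B (f \<odot> X) = f \<odot> B X"
  by (simp_all add: B_def)

lemma eta_nab: "X \<in> \<XX> \<Longrightarrow> Y \<in> \<XX> \<Longrightarrow> \<eta> (nab X Y) = X \<rhd> \<eta> Y - g Y (B X)"
  using compat[of X Y \<xi>] by (simp add: B_def)

lemma eta_B [simp]: "X \<in> \<XX> \<Longrightarrow> \<eta> (B X) = 0"
  using eta_nab[of X \<xi>] by (simp add: deriv_const fun_eq_iff B_def)

text \<open>
  This is \<open>d\<eta> = 0\<close>, since \<open>\<eta> = g(\<xi>, \<cdot>)\<close>.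
\<close>
lemma B_sym:
  assumes "X \<in> \<XX>" "Y \<in> \<XX>"
  shows "g (B X) Y = g X (B Y)"
proof -
  have "X \<rhd> \<eta> Y - Y \<rhd> \<eta> X - \<eta> (bracket X Y) = 0"
    using kenmotsu assms by (simp add: almost_kenmotsu_def d_one_form_def)
  then have "g Y (B X) = g X (B Y)"
    using assms by (simp add: torsion_free[symmetric] eta_nab algebra_simps)
  then show ?thesis using metric_sym[of Y "B X"] assms by simp
qed

lemma B_xi [simp]: "B \<xi> = 0"
  by (rule metric_eq_zeroI) (simp_all add: B_sym)

lemma H_X [simp]: "X \<in> \<XX> \<Longrightarrow> H X \<in> \<XX>"
  and H_add [simp]: "X \<in> \<XX> \<Longrightarrow> Y \<in> \<XX> \<Longrightarrow> H (X + Y) = H X + H Y"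
  and H_uminus [simp]: "X \<in> \<XX> \<Longrightarrow> H (- X) = - H X"
  and H_diff [simp]: "X \<in> \<XX> \<Longrightarrow> Y \<in> \<XX> \<Longrightarrow> H (X - Y) = H X - H Y"
  and H_xi [simp]: "H \<xi> = 0"
  and H_sym: "X \<in> \<XX> \<Longrightarrow> Y \<in> \<XX> \<Longrightarrow> g (H X) Y = g X (H Y)"
  and eta_H [simp]: "X \<in> \<XX> \<Longrightarrow> \<eta> (H X) = 0"
  by (simp_all add: H_def B_sym vf_scale_simps algebra_simps)

text \<open>
  The equation \<open>d\<Phi> = 2 \<eta> \<and> \<Phi>\<close> with \<open>\<xi>\<close> as one argument, that is, \<open>L\<^sub>\<xi> \<Phi> = 2 \<Phi>\<close>, written in terms
  of the connection.
\<close>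
lemma xi_phi:
  assumes X: "X \<in> \<XX>"
  shows "nab \<xi> (\<phi> X) - \<phi> (nab \<xi> X) + B (\<phi> X) + \<phi> (B X) = \<phi> X + \<phi> X"
proof (rule metric_eqI)
  fix Y p assume Y: "Y \<in> \<XX>"
  have "d_two_form (fundamental_form \<phi> g) \<xi> Y X = 2 *\<^sub>R wedge_12 \<eta> (fundamental_form \<phi> g) \<xi> Y X"
    using kenmotsu X Y by (simp add: almost_kenmotsu_def)
  then have "g (nab \<xi> Y) (\<phi> X) + g Y (nab \<xi> (\<phi> X)) - g (nab \<xi> Y - B Y) (\<phi> X)
      + g (nab \<xi> X - B X) (\<phi> Y) = g Y (\<phi> X) + g Y (\<phi> X)"
    using X Y unfolding d_two_form_def wedge_12_def fundamental_form_abs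
    by (simp add: deriv_const compat torsion_free[symmetric] B_def scaleR_2 algebra_simps)
  moreover have "g (nab \<xi> X - B X) (\<phi> Y) = - g Y (\<phi> (nab \<xi> X - B X))"
    using X Y metric_sym[of "nab \<xi> X - B X" "\<phi> Y"] by (simp add: phi_skew)
  moreover have "g (B Y) (\<phi> X) = g Y (B (\<phi> X))" using X Y by (simp add: B_sym)
  moreover have "g Y (\<phi> X + \<phi> X) = g Y (\<phi> X) + g Y (\<phi> X)"
    using X Y by (intro metric_add) simp_all
  ultimately have "g Y (nab \<xi> (\<phi> X) - \<phi> (nab \<xi> X) + B (\<phi> X) + \<phi> (B X)) = g Y (\<phi> X + \<phi> X)"
    using X Y by (simp only:) (simp add: algebra_simps)
  then show "g (nab \<xi> (\<phi> X) - \<phi> (nab \<xi> X) + B (\<phi> X) + \<phi> (B X)) Y p = g (\<phi> X + \<phi> X) Y p"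
    using X Y by (simp only: metric_sym[of Y] V_add V_diff V_nab phi_X xi_X B_X)
qed (use X in \<open>simp only: V_add V_diff V_nab phi_X B_X xi_X\<close>)+

text \<open>
  Since \<open>\<phi>\<^sup>2 = -1 + \<eta> \<otimes> \<xi>\<close> is constant along \<open>\<xi>\<close>, the operator \<open>F = \<nabla>\<^sub>\<xi> \<phi>\<close> anticommutes with \<open>\<phi>\<close>.
  By \<open>xi_phi\<close>, however, \<open>F = 2\<phi> - B\<phi> - \<phi>B\<close>, whose anticommutator with \<open>\<phi>\<close> is
  \<open>2 (2 \<phi>\<^sup>2 + B - \<phi>B\<phi>)\<close>. So this vanishes, and applying \<open>\<phi>\<close> to it gives the claim, hence \<open>F = 0\<close>.
\<close>
lemma B_phi:
  assumes X: "X \<in> \<XX>"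
  shows "B (\<phi> X) + \<phi> (B X) = \<phi> X + \<phi> X"
proof -
  define F where "F X = nab \<xi> (\<phi> X) - \<phi> (nab \<xi> X)" for X
  have F: "F Y = \<phi> Y + \<phi> Y - B (\<phi> Y) - \<phi> (B Y)" if "Y \<in> \<XX>" for Y
    using xi_phi[OF that] by (simp add: F_def algebra_simps)
  have "\<eta> (nab \<xi> X) = \<xi> \<rhd> \<eta> X"
    using X eta_nab[of \<xi> X] metric_sym[of X 0] V_diff[OF X X] by simp
  then have "F (\<phi> X) + \<phi> (F X) = 0"
    using X by (simp add: F_def phi_phi nab_leibniz B_def[of \<xi>, symmetric] vf_scale_simps)
  moreover have e1: "\<phi> (F X) = \<phi> (\<phi> X) + \<phi> (\<phi> X) - \<phi> (B (\<phi> X)) - \<phi> (\<phi> (B X))"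
    by (simp only: F[OF X] phi_add phi_diff phi_X B_X V_add V_diff X)
  moreover have e2: "B (\<phi> (\<phi> X)) = - B X" "\<phi> (\<phi> (B X)) = - B X"
    using X by (simp_all add: phi_phi)
  ultimately have "(\<phi> (\<phi> X) + \<phi> (\<phi> X) + B X - \<phi> (B (\<phi> X))) + (\<phi> (\<phi> X) + \<phi> (\<phi> X) + B X - \<phi> (B (\<phi> X))) = 0"
    unfolding e1 F[OF phi_X[OF X]] e2 by (simp add: algebra_simps)
  from arg_cong[OF double_eq_zeroD[OF this], of \<phi>]
  have "\<phi> (\<phi> (\<phi> X)) + \<phi> (\<phi> (\<phi> X)) + \<phi> (B X) - \<phi> (\<phi> (B (\<phi> X))) = 0"
    by (simp only: phi_zero phi_add phi_diff phi_X B_X V_add V_diff X)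
  then show ?thesis
    using X phi_phi[of "\<phi> X"] phi_phi[of "B (\<phi> X)"] by (simp add: vf_scale_simps algebra_simps)
qed

lemma xi_phi_parallel: "X \<in> \<XX> \<Longrightarrow> nab \<xi> (\<phi> X) = \<phi> (nab \<xi> X)"
  using xi_phi[of X] B_phi[of X] by (simp add: algebra_simps)

lemma H_phi: "X \<in> \<XX> \<Longrightarrow> H (\<phi> X) = - \<phi> (H X)"
  using B_phi[of X] by (simp add: H_def vf_scale_simps algebra_simps)

lemma h_tensor_eq: "X \<in> \<XX> \<Longrightarrow> h_tensor \<phi> \<xi> X = \<phi> (H X)"
proof -
  assume X: "X \<in> \<XX>"
  have "lie_derivative_11 \<xi> \<phi> X = \<phi> (H X) + \<phi> (H X)"
    using X H_phi[OF X]
    by (simp add: lie_derivative_11_def torsion_free[symmetric] xi_phi_parallel H_def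
        B_def[symmetric] vf_scale_simps algebra_simps)
  then show ?thesis by (simp add: h_tensor_def scaleR_fun_def fun_eq_iff)
qed

lemma phi_h_tensor: "X \<in> \<XX> \<Longrightarrow> \<phi> (h_tensor \<phi> \<xi> X) = - H X"
  by (simp add: h_tensor_eq phi_phi vf_scale_simps)

end

section \<open>The horizontal distribution\<close>

context almost_kenmotsu_connection
begin

lemma smooth_closed [simp]:
  "f \<in> smooth_functions A \<Longrightarrow> k \<in> smooth_functions A \<Longrightarrow> f + k \<in> smooth_functions A"
  "f \<in> smooth_functions A \<Longrightarrow> k \<in> smooth_functions A \<Longrightarrow> f - k \<in> smooth_functions A"
  "f \<in> smooth_functions A \<Longrightarrow> k \<in> smooth_functions A \<Longrightarrow> f * k \<in> smooth_functions A"
  "f \<in> smooth_functions A \<Longrightarrow> - f \<in> smooth_functions A"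
  "0 \<in> smooth_functions A" "1 \<in> smooth_functions A"
  by (simp_all add: smooth_add smooth_diff smooth_mult smooth_uminus smooth_zero smooth_one atlas)

definition horizontal :: "'a vector_field set"
  where "horizontal = {X \<in> \<XX>. \<eta> X = 0}"

definition nab_leaf :: "'a vector_field \<Rightarrow> 'a vector_field \<Rightarrow> 'a vector_field"
  where "nab_leaf X Y = nab X Y - \<eta> (nab X Y) \<odot> \<xi>"

lemma horizontalD: "X \<in> horizontal \<Longrightarrow> X \<in> \<XX>" "X \<in> horizontal \<Longrightarrow> \<eta> X = 0"
  by (simp_all add: horizontal_def)

lemma horizontal_part: "X \<in> \<XX> \<Longrightarrow> X - \<eta> X \<odot> \<xi> \<in> horizontal"
  by (simp add: horizontal_def)

lemma B_horizontal: "X \<in> horizontal \<Longrightarrow> B X = H X + X"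
  by (simp add: H_def horizontal_def)

lemma phi_phi_horizontal: "X \<in> horizontal \<Longrightarrow> \<phi> (\<phi> X) = - X"
  by (simp add: phi_phi horizontal_def)

lemma horizontal_involutive:
  assumes "X \<in> horizontal" "Y \<in> horizontal"
  shows "bracket X Y \<in> horizontal"
proof -
  have "d_one_form \<eta> X Y = 0"
    using kenmotsu assms by (simp add: almost_kenmotsu_def horizontal_def)
  then show ?thesis using assms by (simp add: d_one_form_def horizontal_def deriv_const)
qed

lemma nab_xi_horizontal: "X \<in> horizontal \<Longrightarrow> nab \<xi> X \<in> horizontal"
  by (simp add: horizontal_def eta_nab deriv_const)

lemma leaf_connection: "metric_connection_on A horizontal g nab_leaf"
proof -
  have closed: "X \<in> \<XX>" "X + Y \<in> horizontal" "nab_leaf X Y \<in> horizontal"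
    if "X \<in> horizontal" "Y \<in> horizontal" for X Y
    using that by (simp_all add: horizontal_def nab_leaf_def)
  have scale: "f \<odot> X \<in> horizontal"
      "nab_leaf X (f \<odot> Y) = (X \<rhd> f) \<odot> Y + f \<odot> nab_leaf X Y"
    if "X \<in> horizontal" "Y \<in> horizontal" "f \<in> smooth_functions A" for X Y f
    using that vector_fieldD(2)[of X A f]
    by (simp_all add: horizontal_def nab_leaf_def vf_scale_simps nab_leibniz algebra_simps)
  have add: "nab_leaf (X + Y) Z = nab_leaf X Z + nab_leaf Y Z"
    "nab_leaf X (Y + Z) = nab_leaf X Y + nab_leaf X Z"
    and compatible: "X \<rhd> g Y Z = g (nab_leaf X Y) Z + g Y (nab_leaf X Z)"
    if "X \<in> horizontal" "Y \<in> horizontal" "Z \<in> horizontal" for X Y Z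
    using that by (simp_all add: horizontal_def nab_leaf_def vf_scale_simps compat algebra_simps)
  have torsion: "nab_leaf X Y - nab_leaf Y X = bracket X Y"
    if D: "X \<in> horizontal" "Y \<in> horizontal" for X Y
  proof -
    note D' = D[THEN horizontalD(1)] D[THEN horizontalD(2)]
    have "\<eta> (nab X Y - nab Y X) = 0"
      using horizontal_involutive[OF D] D' by (simp only: torsion_free) (simp add: horizontal_def)
    then have "\<eta> (nab X Y) = \<eta> (nab Y X)" using D' by simp
    then show ?thesis using D' by (simp add: nab_leaf_def torsion_free[symmetric])
  qed
  show ?thesis
    by unfold_locales
      (assumption | rule atlas metric horizontalD(1) closed(2,3) scale add torsion compatible
        horizontal_involutive)+
qed

text \<open>
  With \<open>\<nabla>\<^sub>X Y = nab_leaf X Y - g(BX, Y) \<xi>\<close> on horizontal fields, the only horizontal contribution of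
  the normal part to \<open>\<nabla>\<^sub>X \<nabla>\<^sub>Y Z\<close> is \<open>- g(BY, Z) \<nabla>\<^sub>X \<xi> = - g(BY, Z) BX\<close>.
\<close>
lemma gauss_equation:
  assumes D: "X \<in> horizontal" "Y \<in> horizontal" "Z \<in> horizontal" "W \<in> horizontal"
  shows "g (curvature nab X Y Z) W = g (curvature nab_leaf X Y Z) W
    - (g (B Y) Z * g (B X) W - g (B X) Z * g (B Y) W)"
proof -
  note D' = D[THEN horizontalD(1)] D[THEN horizontalD(2)]
  have split: "nab P Q = nab_leaf P Q - g (B P) Q \<odot> \<xi>" if "P \<in> horizontal" "Q \<in> horizontal" for P Q
    using that horizontalD[OF that(1)] horizontalD[OF that(2)] metric_sym[of Q "B P"]
    by (simp add: nab_leaf_def eta_nab deriv_const vf_scale_simps)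
  interpret leaf: metric_connection_on A horizontal g nab_leaf by (rule leaf_connection)
  have nn: "g (nab P (nab Q U)) W = g (nab_leaf P (nab_leaf Q U)) W - g (B Q) U * g (B P) W"
    if P: "P \<in> horizontal" "Q \<in> horizontal" "U \<in> horizontal" for P Q U
  proof -
    note P' = P[THEN horizontalD(1)]
    have L: "nab_leaf Q U \<in> horizontal" using P by simp
    note L' = horizontalD(1)[OF L]
    have "nab P (nab Q U) = nab P (nab_leaf Q U) - ((P \<rhd> g (B Q) U) \<odot> \<xi> + g (B Q) U \<odot> B P)"
      using P' L' vector_fieldD(2)[OF P'(1)] by (simp add: split[OF P(2,3)] nab_leibniz B_def)
    also have "\<dots> = nab_leaf P (nab_leaf Q U) - g (B P) (nab_leaf Q U) \<odot> \<xi>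
        - ((P \<rhd> g (B Q) U) \<odot> \<xi> + g (B Q) U \<odot> B P)"
      by (simp only: split[OF P(1) L])
    finally show ?thesis
      using P' L' D' vector_fieldD(2)[OF P'(1)] horizontalD(1)[OF leaf.V_nab[OF P(1) L]] by simp
  qed
  have b: "g (nab (bracket X Y) Z) W = g (nab_leaf (bracket X Y) Z) W"
    using D' D horizontalD[OF leaf.V_nab[of "bracket X Y" Z]]
    by (simp add: split)
  have "g (curvature nab X Y Z) W
      = g (nab X (nab Y Z)) W - g (nab Y (nab X Z)) W - g (nab (bracket X Y) Z) W"
    using D' by (simp add: curvature_def)
  moreover have "g (nab_leaf X (nab_leaf Y Z)) W = g (curvature nab_leaf X Y Z) W
      + g (nab_leaf Y (nab_leaf X Z)) W + g (nab_leaf (bracket X Y) Z) W"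
    using D by (simp add: curvature_def)
  ultimately show ?thesis using D by (simp add: nn b algebra_simps)
qed

text \<open>
  Any argument can be replaced by its horizontal part: the last one because \<open>E\<close> is linear in it and
  \<open>E(X,Y,Z,\<xi>) = - E(X,Y,\<xi>,Z) = 0\<close>, the others by the symmetries, which carry the
  linearity over from the last argument, where it is evident for \<open>g(R(X,Y)Z, W)\<close>.
\<close>
lemma curvature_like_zero:
  fixes E :: "'a vector_field \<Rightarrow> 'a vector_field \<Rightarrow> 'a vector_field \<Rightarrow> 'a vector_field \<Rightarrow> real"
  assumes skew: "\<And>X Y Z W. \<lbrakk>X \<in> \<XX>; Y \<in> \<XX>; Z \<in> \<XX>; W \<in> \<XX>\<rbrakk> \<Longrightarrow> E X Y Z W = - E X Y W Z"
    and pair: "\<And>X Y Z W. \<lbrakk>X \<in> \<XX>; Y \<in> \<XX>; Z \<in> \<XX>; W \<in> \<XX>\<rbrakk> \<Longrightarrow> E X Y Z W = E Z W X Y"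
    and linear: "\<And>X Y Z W f. \<lbrakk>X \<in> \<XX>; Y \<in> \<XX>; Z \<in> \<XX>; W \<in> \<XX>; f \<in> smooth_functions A\<rbrakk> \<Longrightarrow>
      E X Y Z (W + f \<odot> \<xi>) = E X Y Z W + f p * E X Y Z \<xi>"
    and xi: "\<And>X Y W. \<lbrakk>X \<in> \<XX>; Y \<in> \<XX>; W \<in> \<XX>\<rbrakk> \<Longrightarrow> E X Y \<xi> W = 0"
    and horizontal: "\<And>X Y Z W. \<lbrakk>X \<in> horizontal; Y \<in> horizontal; Z \<in> horizontal; W \<in> horizontal\<rbrakk> \<Longrightarrow>
      E X Y Z W = 0"
    and X: "X \<in> \<XX>" "Y \<in> \<XX>" "Z \<in> \<XX>" "W \<in> \<XX>"
  shows "E X Y Z W = 0"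
proof -
  define P where "P X = X - \<eta> X \<odot> \<xi>" for X
  have P: "P X \<in> horizontal" "P X \<in> \<XX>" if "X \<in> \<XX>" for X
    using that horizontal_part by (simp_all add: P_def)
  have 4: "E X Y Z W = E X Y Z (P W)" if "X \<in> \<XX>" "Y \<in> \<XX>" "Z \<in> \<XX>" "W \<in> \<XX>" for X Y Z W
    using linear[of X Y Z "P W" "\<eta> W"] that P(2) skew[of X Y Z \<xi>] xi[of X Y Z]
    by (simp add: P_def)
  have 34: "E X Y Z W = E X Y (P Z) (P W)" if "X \<in> \<XX>" "Y \<in> \<XX>" "Z \<in> \<XX>" "W \<in> \<XX>" for X Y Z W
    using that P(2) 4[of X Y Z W] 4[of X Y "P W" Z] skew[of X Y Z "P W"] skew[of X Y "P Z" "P W"]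
    by simp
  have "E X Y Z W = E X Y (P Z) (P W)" using 34 X by simp
  also have "\<dots> = E (P Z) (P W) X Y" using X P(2) by (intro pair) simp_all
  also have "\<dots> = E (P Z) (P W) (P X) (P Y)" using X P(2) by (intro 34) simp_all
  also have "\<dots> = 0" using X P(1) by (intro horizontal) simp_all
  finally show ?thesis .
qed

end

section \<open>The nullity condition\<close>

locale kmn_kenmotsu = almost_kenmotsu_connection A \<phi> \<xi> \<eta> g nab
  for A :: "('a::{t2_space, second_countable_topology}, 'e::euclidean_space) atlas"
    and \<phi> :: "'a vector_field \<Rightarrow> 'a vector_field"
    and \<xi> :: "'a vector_field"
    and \<eta> :: "'a vector_field \<Rightarrow> 'a \<Rightarrow> real"
    and g :: "'a vector_field \<Rightarrow> 'a vector_field \<Rightarrow> 'a \<Rightarrow> real"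
    and nab :: "'a vector_field \<Rightarrow> 'a vector_field \<Rightarrow> 'a vector_field" +
  fixes \<kappa> \<mu> \<nu> :: "'a \<Rightarrow> real"
  assumes kmn: "kmn_space A \<phi> \<xi> \<eta> g nab \<kappa> \<mu> \<nu>"
begin

lemma kmn_smooth [simp]:
  "\<kappa> \<in> smooth_functions A" "\<mu> \<in> smooth_functions A" "\<nu> \<in> smooth_functions A"
  using kmn by (simp_all add: kmn_space_def)

text \<open>
  The nullity condition rewritten with \<open>h = \<phi> H\<close> and \<open>\<phi> h = - H\<close>.
\<close>
lemma curvature_xi:
  assumes "X \<in> \<XX>" "Y \<in> \<XX>"
  shows "curvature nab X Y \<xi> = \<kappa> \<odot> (\<eta> Y \<odot> X - \<eta> X \<odot> Y)
    + \<mu> \<odot> (\<eta> Y \<odot> \<phi> (H X) - \<eta> X \<odot> \<phi> (H Y)) + \<nu> \<odot> (\<eta> X \<odot> H Y - \<eta> Y \<odot> H X)"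
proof -
  have "curvature nab X Y \<xi> = \<kappa> \<odot> (\<eta> Y \<odot> X - \<eta> X \<odot> Y)
      + \<mu> \<odot> (\<eta> Y \<odot> h_tensor \<phi> \<xi> X - \<eta> X \<odot> h_tensor \<phi> \<xi> Y)
      + \<nu> \<odot> (\<eta> Y \<odot> \<phi> (h_tensor \<phi> \<xi> X) - \<eta> X \<odot> \<phi> (h_tensor \<phi> \<xi> Y))"
    using kmn assms by (simp add: kmn_space_def)
  then show ?thesis
    using assms by (simp only: phi_h_tensor h_tensor_eq) (simp add: phi_phi vf_scale_simps)
qed

text \<open>
  On \<open>D\<close>, \<open>R(X,\<xi>)\<xi> = - (\<nabla>\<^sub>\<xi> B) X - B\<^sup>2 X\<close> with \<open>B = 1 + H\<close>. In the nullity condition for it, the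
  terms \<open>\<nabla>\<^sub>\<xi> H\<close>, \<open>2 H\<close>, \<open>\<mu> h\<close> and \<open>\<nu> \<phi> h\<close> anticommute with \<open>\<phi>\<close>, whereas \<open>1\<close>, \<open>H\<^sup>2\<close> and \<open>\<kappa>\<close> commute
  with it. Comparing the equation at \<open>\<phi> X\<close> with \<open>\<phi>\<close> applied to the equation at \<open>X\<close> isolates the
  latter.
\<close>
lemma H_square:
  assumes X: "X \<in> horizontal"
  shows "H (H X) = - (\<kappa> + 1) \<odot> X"
proof -
  note X' = horizontalD[OF X]
  define G where "G X = nab \<xi> (H X) - H (nab \<xi> X)" for X
  have eq: "G Y + H (H Y) + H Y + H Y + Y + \<kappa> \<odot> Y + \<mu> \<odot> \<phi> (H Y) - \<nu> \<odot> H Y = 0"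
    if Y: "Y \<in> horizontal" for Y
  proof -
    note Y' = horizontalD[OF Y]
    have br: "bracket Y \<xi> = B Y - nab \<xi> Y" using Y' by (simp add: torsion_free[symmetric] B_def)
    have "curvature nab Y \<xi> \<xi> = - nab \<xi> (B Y) - B (B Y) + B (nab \<xi> Y)"
      using Y' by (simp only: curvature_def br B_def[symmetric] B_xi nab_zero) simp
    also have "\<dots> = - nab \<xi> (H Y + Y) - (H (H Y) + H Y + (H Y + Y)) + (H (nab \<xi> Y) + nab \<xi> Y)"
      using Y' B_horizontal[OF Y] B_horizontal[OF nab_xi_horizontal[OF Y]] B_horizontal[of "H Y"]
      by (simp add: horizontal_def)
    finally have "curvature nab Y \<xi> \<xi> = - nab \<xi> (H Y + Y) - (H (H Y) + H Y + (H Y + Y))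
      + (H (nab \<xi> Y) + nab \<xi> Y)" .
    moreover have "curvature nab Y \<xi> \<xi> = \<kappa> \<odot> Y + \<mu> \<odot> \<phi> (H Y) - \<nu> \<odot> H Y"
      using curvature_xi[of Y \<xi>] Y' by (simp add: vf_scale_simps)
    ultimately show ?thesis using Y' by (simp add: G_def algebra_simps)
  qed
  have phiX: "\<phi> X \<in> horizontal" and HX: "H X \<in> horizontal" and HHX: "H (H X) \<in> horizontal"
    using X' by (simp_all add: horizontal_def)
  have G_phi: "G (\<phi> X) = - \<phi> (G X)"
    using X' H_phi[of "nab \<xi> X"] by (simp add: G_def xi_phi_parallel H_phi)
  have G_X: "G X \<in> \<XX>" using X' by (simp add: G_def)
  have "\<phi> (G X + H (H X) + H X + H X + X + \<kappa> \<odot> X + \<mu> \<odot> \<phi> (H X) - \<nu> \<odot> H X) = 0"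
    by (simp only: eq[OF X] phi_zero)
  then have e1: "\<phi> (G X) + \<phi> (H (H X)) + \<phi> (H X) + \<phi> (H X) + \<phi> X + \<kappa> \<odot> \<phi> X + \<mu> \<odot> - H X
      - \<nu> \<odot> \<phi> (H X) = 0"
    using X' G_X kmn_smooth phi_phi_horizontal[OF HX]
    by (simp only: phi_add phi_diff phi_scale phi_X V_add V_diff V_scale H_X)
  have e2: "- \<phi> (G X) + \<phi> (H (H X)) - \<phi> (H X) - \<phi> (H X) + \<phi> X + \<kappa> \<odot> \<phi> X + \<mu> \<odot> H X
      + \<nu> \<odot> \<phi> (H X) = 0"
    using eq[OF phiX] X' phi_phi_horizontal[OF HX] by (simp add: G_phi H_phi vf_scale_simps)
  have "(\<phi> (H (H X)) + \<phi> X + \<kappa> \<odot> \<phi> X) p f = 0 p f" for p f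
    using fun_cong[OF fun_cong[OF e1, of p], of f] fun_cong[OF fun_cong[OF e2, of p], of f]
    by (simp add: vf_scale_simps)
  then have "\<phi> (H (H X)) + \<phi> X + \<kappa> \<odot> \<phi> X = 0" by (intro ext)
  from arg_cong[OF this, of \<phi>]
  have "\<phi> (\<phi> (H (H X))) + \<phi> (\<phi> X) + \<kappa> \<odot> \<phi> (\<phi> X) = 0"
    using X' kmn_smooth
    by (simp only: phi_zero phi_add phi_diff phi_scale phi_X V_add V_diff V_scale H_X)
  then show ?thesis
    using phi_phi_horizontal[OF X] phi_phi_horizontal[OF HHX]
    by (simp add: vf_scale_simps algebra_simps)
qed

text \<open>
  The right hand side of the nullity condition vanishes on horizontal fields, and the left hand side
  is the Codazzi expression of \<open>B = 1 + H\<close>, in which the identity cancels by torsion-freeness.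
\<close>
lemma H_codazzi:
  assumes D: "X \<in> horizontal" "Y \<in> horizontal"
  shows "nab X (H Y) - nab Y (H X) = H (bracket X Y)"
proof -
  note D' = D[THEN horizontalD(1)] D[THEN horizontalD(2)]
  have "nab X (B Y) - nab Y (B X) - B (bracket X Y) = curvature nab X Y \<xi>"
    by (simp add: curvature_def B_def)
  also have "\<dots> = 0" using curvature_xi[of X Y] D' by simp
  finally have "nab X (H Y + Y) - nab Y (H X + X) - (H (bracket X Y) + bracket X Y) = 0"
    by (simp only: B_horizontal D horizontal_involutive)
  then show ?thesis using D' by (simp add: torsion_free[symmetric] algebra_simps)
qed

lemma leaf_split_almost_kaehler:
  assumes neg: "\<And>p. \<kappa> p < -1" and along: "varies_only_along A g \<xi> \<kappa>"
  shows "split_almost_kaehler A horizontal g nab_leaf H \<phi> (- (\<kappa> + 1))"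
proof -
  interpret leaf: metric_connection_on A horizontal g nab_leaf by (rule leaf_connection)
  have H_leaf: "H X \<in> horizontal" "H (H X) = - (\<kappa> + 1) \<odot> X" "\<phi> X \<in> horizontal"
    "\<phi> (\<phi> X) = - X" "H (\<phi> X) = - \<phi> (H X)" if "X \<in> horizontal" for X
    using H_square[OF that] H_phi[of X] phi_phi_horizontal[OF that] horizontalD[OF that]
    by (simp_all add: horizontal_def)
  have sym_leaf: "H (X + Y) = H X + H Y" "g (H X) Y = g X (H Y)" "\<phi> (X + Y) = \<phi> X + \<phi> Y"
    "g (\<phi> X) Y = - g X (\<phi> Y)" if "X \<in> horizontal" "Y \<in> horizontal" for X Y
    using horizontalD(1)[OF that(1)] horizontalD(1)[OF that(2)] by (simp_all add: H_sym phi_skew)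
  have const_leaf: "X \<rhd> (- (\<kappa> + 1)) = 0" if "X \<in> horizontal" for X
  proof -
    note X' = horizontalD[OF that]
    have "X \<rhd> \<kappa> = 0" using along X' by (simp add: varies_only_along_def)
    then show ?thesis
      using tangent_uminus[OF vector_fieldD(1)[OF X'(1)], of "\<kappa> + 1"]
        tangentD(1)[OF vector_fieldD(1)[OF X'(1)], of \<kappa> 1] deriv_const(2)[OF X'(1)]
      by (simp add: vf_apply_def fun_eq_iff)
  qed
  have codazzi_leaf: "nab_leaf X (H Y) - nab_leaf Y (H X) = H (bracket X Y)"
    if D: "X \<in> horizontal" "Y \<in> horizontal" for X Y
  proof -
    note D' = D[THEN horizontalD(1)]
    have "\<eta> (nab X (H Y)) = \<eta> (nab Y (H X))"
      using arg_cong[OF H_codazzi[OF D], of \<eta>] D' by simp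
    then show ?thesis using H_codazzi[OF D] by (simp add: nab_leaf_def)
  qed
  have closed_leaf: "d_two_form (fundamental_form \<phi> g) X Y Z = 0"
    if "X \<in> horizontal" "Y \<in> horizontal" "Z \<in> horizontal" for X Y Z
    using kenmotsu that by (simp add: almost_kenmotsu_def wedge_12_def horizontal_def)
  have c: "- (\<kappa> + 1) \<in> smooth_functions A" "(- (\<kappa> + 1)) p \<noteq> 0" for p
    using neg[of p] by simp_all
  show ?thesis
    by unfold_locales
      (assumption | rule H_leaf sym_leaf const_leaf codazzi_leaf closed_leaf c)+
qed

end

section \<open>The curvature tensor\<close>

context kmn_kenmotsu
begin

definition model :: "'a vector_field \<Rightarrow> 'a vector_field \<Rightarrow> 'a vector_field \<Rightarrow> 'a vector_field" where
  "model X Y Z = - R1 g X Y Z - (\<kappa> + 1) \<odot> R3 \<xi> \<eta> g X Y Z - R52 \<phi> (h_tensor \<phi> \<xi>) g X Y Z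
     - \<mu> \<odot> R6 (h_tensor \<phi> \<xi>) \<xi> \<eta> g X Y Z + R7 \<phi> (h_tensor \<phi> \<xi>) g X Y Z
     - (\<nu> - 1) \<odot> R8 \<phi> (h_tensor \<phi> \<xi>) \<xi> \<eta> g X Y Z"

lemmas tensor_defs = R1_def R3_def R52_def R6_def R7_def R8_def

lemma model_X [simp]: "\<lbrakk>X \<in> \<XX>; Y \<in> \<XX>; Z \<in> \<XX>\<rbrakk> \<Longrightarrow> model X Y Z \<in> \<XX>"
  by (simp add: model_def tensor_defs h_tensor_eq phi_phi)

lemma metric_model:
  assumes "X \<in> \<XX>" "Y \<in> \<XX>" "Z \<in> \<XX>" "W \<in> \<XX>"
  shows "g (model X Y Z) W p =
    - (g Y Z p * g X W p - g X Z p * g Y W p)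
    - (\<kappa> p + 1) * (\<eta> X p * \<eta> Z p * g Y W p - \<eta> Y p * \<eta> Z p * g X W p
        + g X Z p * \<eta> Y p * \<eta> W p - g Y Z p * \<eta> X p * \<eta> W p)
    - (g (H Y) Z p * g (H X) W p - g (H X) Z p * g (H Y) W p)
    - \<mu> p * (\<eta> X p * \<eta> Z p * g (\<phi> (H Y)) W p - \<eta> Y p * \<eta> Z p * g (\<phi> (H X)) W p
        + g (\<phi> (H X)) Z p * \<eta> Y p * \<eta> W p - g (\<phi> (H Y)) Z p * \<eta> X p * \<eta> W p)
    + (g X Z p * g (H Y) W p - g Y Z p * g (H X) W p
        + g (H X) Z p * g Y W p - g (H Y) Z p * g X W p)
    - (\<nu> p - 1) * (\<eta> Y p * \<eta> Z p * g (H X) W p - \<eta> X p * \<eta> Z p * g (H Y) W p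
        + g (H Y) Z p * \<eta> X p * \<eta> W p - g (H X) Z p * \<eta> Y p * \<eta> W p)"
  using assms
  by (simp add: model_def tensor_defs h_tensor_eq phi_phi algebra_simps)

text \<open>
  The difference of the two sides is an algebraic curvature tensor. With an argument \<open>\<xi>\<close> it vanishes
  by the nullity condition, and on horizontal arguments by the Gauss equation, as the leaves are
  flat.
\<close>
lemma curvature_eq_model:
  assumes neg: "\<And>p. \<kappa> p < -1" and along: "varies_only_along A g \<xi> \<kappa>"
    and V: "X \<in> \<XX>" "Y \<in> \<XX>" "Z \<in> \<XX>"
  shows "curvature nab X Y Z = model X Y Z"
proof (rule metric_eqI)
  interpret leaf: split_almost_kaehler A horizontal g nab_leaf H \<phi> "- (\<kappa> + 1)"
    using neg along by (rule leaf_split_almost_kaehler)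
  fix W p assume W: "W \<in> \<XX>"
  define E where "E X Y Z W = g (curvature nab X Y Z) W p - g (model X Y Z) W p" for X Y Z W
  have sym: "g X Y p = g Y X p" "g (H X) Y p = g (H Y) X p"
    "g (\<phi> (H X)) Y p = g (\<phi> (H Y)) X p" if "X \<in> \<XX>" "Y \<in> \<XX>" for X Y
    using that metric_sym[of X Y] metric_sym[of X "H Y"] metric_sym[of X "\<phi> (H Y)"] H_sym[of X "\<phi> Y"]
    by (simp_all add: H_sym phi_skew H_phi)
  have "E X Y Z W = 0"
  proof (rule curvature_like_zero[where p = p, OF _ _ _ _ _ V W])
    fix X Y Z W f assume V: "X \<in> \<XX>" "Y \<in> \<XX>" "Z \<in> \<XX>" "W \<in> \<XX>"
    have "g (model X Y Z) W p = - g (model X Y W) Z p"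
      using V by (simp only: metric_model) (simp add: algebra_simps)
    then show "E X Y Z W = - E X Y W Z"
      using curvature_metric_skew[OF V] by (simp add: E_def)
    have "g (model X Y Z) W p = g (model Z W X) Y p"
      unfolding metric_model[OF V] metric_model[OF V(3,4,1,2)]
        sym[OF V(3,1)] sym[OF V(3,2)] sym[OF V(4,1)] sym[OF V(4,2)]
      by (simp add: algebra_simps)
    then show "E X Y Z W = E Z W X Y"
      using curvature_pair[OF V] by (simp add: E_def)
  next
    fix X Y Z W f assume V: "X \<in> \<XX>" "Y \<in> \<XX>" "Z \<in> \<XX>" "W \<in> \<XX>" "f \<in> smooth_functions A"
    then show "E X Y Z (W + f \<odot> \<xi>) = E X Y Z W + f p * E X Y Z \<xi>"
      by (simp add: E_def algebra_simps del: metric_xi)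
  next
    fix X Y W assume V: "X \<in> \<XX>" "Y \<in> \<XX>" "W \<in> \<XX>"
    then show "E X Y \<xi> W = 0"
      by (simp add: E_def metric_model curvature_xi algebra_simps)
  next
    fix X Y Z W
    assume D: "X \<in> horizontal" "Y \<in> horizontal" "Z \<in> horizontal" "W \<in> horizontal"
    note D' = D[THEN horizontalD(1)] D[THEN horizontalD(2)]
    show "E X Y Z W = 0"
      using fun_cong[OF gauss_equation[OF D], of p] D' leaf.flat[OF D(1-3)]
      by (simp add: E_def metric_model B_horizontal[OF D(1)] B_horizontal[OF D(2)] algebra_simps)
  qed
  then show "g (curvature nab X Y Z) W p = g (model X Y Z) W p" by (simp add: E_def)
qed (use V in simp_all)

end

theorem theorem3p23:
  fixes A :: "('a::{t2_space, second_countable_topology}, 'e::euclidean_space) atlas"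
    and \<phi> :: "'a vector_field \<Rightarrow> 'a vector_field"
    and \<xi> :: "'a vector_field"
    and \<eta> :: "'a vector_field \<Rightarrow> 'a \<Rightarrow> real"
    and g :: "'a vector_field \<Rightarrow> 'a vector_field \<Rightarrow> 'a \<Rightarrow> real"
    and nab :: "'a vector_field \<Rightarrow> 'a vector_field \<Rightarrow> 'a vector_field"
    and \<kappa> \<mu> \<nu> :: "'a \<Rightarrow> real"
  assumes "almost_kenmotsu A \<phi> \<xi> \<eta> g"
    and "kmn_space A \<phi> \<xi> \<eta> g nab \<kappa> \<mu> \<nu>"
    and "\<forall>p. \<kappa> p < -1"
    and "varies_only_along A g \<xi> \<kappa>"
  shows "(\<forall>X\<in>vector_fields A. \<forall>Y\<in>vector_fields A. \<forall>Z\<in>vector_fields A.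
            curvature nab X Y Z =
              - R1 g X Y Z - (\<kappa> + 1) \<odot> R3 \<xi> \<eta> g X Y Z - R52 \<phi> (h_tensor \<phi> \<xi>) g X Y Z
              - \<mu> \<odot> R6 (h_tensor \<phi> \<xi>) \<xi> \<eta> g X Y Z + R7 \<phi> (h_tensor \<phi> \<xi>) g X Y Z - (\<nu> - 1) \<odot> R8 \<phi> (h_tensor \<phi> \<xi>) \<xi> \<eta> g X Y Z)
       \<and> gen_kmn_space_form_divided A \<phi> \<xi> \<eta> g nab
            (-1) 0 (- (\<kappa> + 1)) 0 0 (-1) (- \<mu>) 1 (- (\<nu> - 1))"
proof -
  interpret kmn_kenmotsu A \<phi> \<xi> \<eta> g nab \<kappa> \<mu> \<nu>
    using assms(1,2) by unfold_locales (simp_all add: kmn_space_def)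
  have curv: "curvature nab X Y Z = model X Y Z" if "X \<in> \<XX>" "Y \<in> \<XX>" "Z \<in> \<XX>" for X Y Z
    using assms(3,4) that by (intro curvature_eq_model) simp_all
  have "gen_kmn_space_form_divided A \<phi> \<xi> \<eta> g nab
            (-1) 0 (- (\<kappa> + 1)) 0 0 (-1) (- \<mu>) 1 (- (\<nu> - 1))"
    unfolding gen_kmn_space_form_divided_def Let_def
    using contact_metric levi_civita curv by (simp add: model_def vf_scale_simps)
  then show ?thesis using curv by (simp add: model_def)
qed

end
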